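(* Let $E\subset\mathbb{C}\setminus\{0\}$ with $0\in\overline{E}$, and for $\varepsilon\in E$ let $S_\varepsilon=\{a_1^\varepsilon,a_2^\varepsilon,a_3^\varepsilon\}\subset\mathbb{D}^2$ with $$a_1^\varepsilon=(0,0),\quad a_2^\varepsilon=(\varepsilon,0),\quad a_3^\varepsilon=(\rho(\varepsilon),\delta(\varepsilon)\rho(\varepsilon)),\qquad \rho(\varepsilon)\ne0,$$ be three distinct points such that $\|a_3^\varepsilon\|\le\|a_3^\varepsilon-a_2^\varepsilon\|\le|\varepsilon|$, $\delta(\varepsilon)\to0$ and $\left|\dfrac{\delta(\varepsilon)}{\varepsilon}\right|\to\infty$ as $\varepsilon\to0$. Let $G_\varepsilon$ be the pluricomplex Green function of $\mathbb{D}^2$ with poles $S_\varepsilon$. Then: (1) For any $z=(z_1,z_2)\in\mathbb{D}^2\setminus\{(0,0)\}$, $$\liminf_{\varepsilon\to0}G_\varepsilon(z_1,z_2)\ \ge\ \max\Big(2\log|z_1|,\ \tfrac32\log|z_2|\Big).$$ (2) For any $z=(z_1,z_2)\in\mathbb{D}^2\setminus\{(0,0)\}$ such that $|z_2|\le|z_1|^2$, $$\lim_{\varepsilon\to0}G_\varepsilon(z_1,z_2)=2\log|z_1|.$$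
   Context: $\mathbb{D}$ is the open unit disk in $\mathbb{C}$, $\|\cdot\|$ the Euclidean norm on $\mathbb{C}^2$, and $\log 0=-\infty$. $PSH_-(\mathbb{D}^2)$ is the set of nonpositive plurisubharmonic functions on $\mathbb{D}^2$. For a finite set $S\subset\mathbb{D}^2$, the pluricomplex Green function with (logarithmic) poles $S$ is $$G_S(z)=\sup\{u(z):\ u\in PSH_-(\mathbb{D}^2),\ u(w)\le\log\|w-a\|+O(1)\text{ as }w\to a,\ \text{for every } a\in S\};$$ this coincides with the Green function of the ideal of holomorphic functions vanishing on $S$. $G_\varepsilon:=G_{S_\varepsilon}$. *)

theory Defs
  imports "HOL-Analysis.Analysis"
begin

definition elog :: "real \<Rightarrow> ereal" where
  "elog x = (if x = 0 then - \<infinity> else ereal (ln x))"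

definition usc_on :: "'a::topological_space set \<Rightarrow> ('a \<Rightarrow> ereal) \<Rightarrow> bool" where
  "usc_on \<Omega> u \<longleftrightarrow> (\<forall>c. openin (top_of_set \<Omega>) {x \<in> \<Omega>. u x < c})"

text \<open>
  Positive and negative parts are integrated separately, because \<open>u\<close> takes values in
  \<open>[-\<infinity>, \<infinity>)\<close> and need not be integrable on the circle; \<^const>\<open>e2ennreal\<close> truncates
  negative arguments to \<open>0\<close>. For upper semicontinuous \<open>u < \<infinity>\<close> the first integral is finite,
  so the difference is never of the form \<open>\<infinity> - \<infinity>\<close>.
\<close>
definition circle_mean :: "(complex \<Rightarrow> ereal) \<Rightarrow> complex \<Rightarrow> real \<Rightarrow> ereal" where
  "circle_mean u c r =
     (enn2ereal (\<integral>\<^sup>+\<theta>\<in>{0..2*pi}. e2ennreal (u (c + of_real r * cis \<theta>)) \<partial>lborel)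
      - enn2ereal (\<integral>\<^sup>+\<theta>\<in>{0..2*pi}. e2ennreal (- u (c + of_real r * cis \<theta>)) \<partial>lborel))
     / ereal (2*pi)"

text \<open>The function that is identically \<open>-\<infinity>\<close> counts as subharmonic and as plurisubharmonic.\<close>
definition subharmonic_on :: "complex set \<Rightarrow> (complex \<Rightarrow> ereal) \<Rightarrow> bool" where
  "subharmonic_on U u \<longleftrightarrow>
     open U \<and> usc_on U u \<and> (\<forall>z\<in>U. u z < \<infinity>) \<and>
     (\<forall>c r. 0 < r \<longrightarrow> cball c r \<subseteq> U \<longrightarrow> u c \<le> circle_mean u c r)"

text \<open>Points of \<open>\<complex>\<^sup>2\<close> are pairs; the library norm on \<^typ>\<open>complex \<times> complex\<close> is the Euclidean one.\<close>
definition psh_on :: "(complex \<times> complex) set \<Rightarrow> (complex \<times> complex \<Rightarrow> ereal) \<Rightarrow> bool" where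
  "psh_on \<Omega> u \<longleftrightarrow>
     open \<Omega> \<and> usc_on \<Omega> u \<and> (\<forall>z\<in>\<Omega>. u z < \<infinity>) \<and>
     (\<forall>a1 a2 b1 b2. (b1, b2) \<noteq> (0, 0) \<longrightarrow>
        subharmonic_on {\<zeta>. (a1 + \<zeta> * b1, a2 + \<zeta> * b2) \<in> \<Omega>}
          (\<lambda>\<zeta>. u (a1 + \<zeta> * b1, a2 + \<zeta> * b2)))"

definition bidisk :: "(complex \<times> complex) set" where
  "bidisk = ball 0 1 \<times> ball 0 1"

definition PSH_minus :: "(complex \<times> complex \<Rightarrow> ereal) set" where
  "PSH_minus = {u. psh_on bidisk u \<and> (\<forall>z\<in>bidisk. u z \<le> 0)}"

definition log_pole_at :: "(complex \<times> complex \<Rightarrow> ereal) \<Rightarrow> complex \<times> complex \<Rightarrow> bool" where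
  "log_pole_at u a \<longleftrightarrow>
     (\<exists>C::real. \<forall>\<^sub>F w in at a. u w \<le> elog (norm (w - a)) + ereal C)"

definition green :: "(complex \<times> complex) set \<Rightarrow> complex \<times> complex \<Rightarrow> ereal" where
  "green S z = (SUP u \<in> {u \<in> PSH_minus. \<forall>a\<in>S. log_pole_at u a}. u z)"

end

theory Submission
  imports Defs
    "HOL-Complex_Analysis.Cauchy_Integral_Formula"
    "HOL-Computational_Algebra.Fundamental_Theorem_Algebra"
begin

text \<open>
  The lower bound comes from two explicit competitors. The three poles lie on the parabola
  \<open>z\<^sub>1 (z\<^sub>1 - \<epsilon>) = c z\<^sub>2\<close> with \<open>c = (\<rho> - \<epsilon>) / \<delta>\<close>, and \<open>\<bar>\<rho> - \<epsilon>\<bar> \<le> \<bar>\<epsilon>\<bar>\<close> together with \<open>\<bar>\<delta> / \<epsilon>\<bar> \<rightarrow> \<infinity>\<close>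
  forces \<open>c \<rightarrow> 0\<close>; so the normalised logarithm of the equation tends to \<open>2 log \<bar>z\<^sub>1\<bar>\<close>
  (\<open>green_ge_conic\<close>). The three lines joining the poles in pairs have slopes \<open>0\<close>, \<open>\<delta>\<close> and
  \<open>\<delta> \<rho> / (\<rho> - \<epsilon>)\<close>, which tend to \<open>0\<close> because \<open>\<bar>\<rho>\<bar> \<le> \<bar>\<rho> - \<epsilon>\<bar>\<close>; the product of their equations has a
  double zero at each pole and tends to \<open>z\<^sub>2\<^sup>3\<close>, so half of its logarithm tends to \<open>3/2 log \<bar>z\<^sub>2\<bar>\<close>
  (\<open>green_ge_three_lines\<close>). That both are plurisubharmonic is Jensen's inequality for
  polynomials (\<open>elog_poly_le_circle_mean\<close>).

  For the upper bound two of the poles suffice. The curve \<open>\<zeta> \<mapsto> (\<zeta>, \<kappa> \<zeta> (\<zeta> - \<epsilon>))\<close> passes through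
  \<open>(0, 0)\<close> and \<open>(\<epsilon>, 0)\<close>, and with \<open>\<kappa> = z\<^sub>2 / (z\<^sub>1 (z\<^sub>1 - \<epsilon>))\<close> also through \<open>(z\<^sub>1, z\<^sub>2)\<close>. As
  \<open>\<bar>z\<^sub>2\<bar> \<le> \<bar>z\<^sub>1\<bar>\<^sup>2\<close>, the limit of \<open>\<bar>\<kappa>\<bar>\<close> is at most \<open>1\<close>, and over every disk of radius \<open>R < 1\<close> the curve
  stays in the bidisk for small \<open>\<epsilon>\<close>. A competitor restricted to it is nonpositive with logarithmic poles
  at \<open>0\<close> and \<open>\<epsilon>\<close>, so at \<open>z\<^sub>1\<close> it is at most \<open>log \<bar>z\<^sub>1\<bar> + log \<bar>z\<^sub>1 - \<epsilon>\<bar> - log (R (R - \<bar>\<epsilon>\<bar>))\<close>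
  (\<open>psh_parabola_two_poles\<close>); letting \<open>\<epsilon> \<rightarrow> 0\<close> and then \<open>R \<rightarrow> 1\<close> gives \<open>2 log \<bar>z\<^sub>1\<bar>\<close>. The definition of
  plurisubharmonicity speaks of straight lines only, so the maximum principle on the curve is proved
  directly, by penalising the distance to the curve and testing on a tangential line
  (\<open>psh_parabola_max_principle\<close>).
\<close>

section \<open>Circular means\<close>

lemma holomorphic_circle_mean:
  assumes "f holomorphic_on cball c r" and "0 < r"
  shows "((\<lambda>t. f (c + of_real r * cis t)) has_integral (of_real (2*pi) * f c)) {0..2*pi}"
proof -
  have "((\<lambda>w. f w / (w - c)) has_contour_integral (2 * of_real pi * \<i> * f c)) (circlepath c r)"
    using Cauchy_integral_circlepath_simple[OF assms(1), of c] assms(2) by simp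
  then have "((\<lambda>t. f (c + of_real r * cis t) / (c + of_real r * cis t - c) * of_real r * \<i> * cis t)
      has_integral (2 * of_real pi * \<i> * f c)) {0..2*pi}"
    unfolding circlepath_def by (subst (asm) has_contour_integral_part_circlepath_iff) auto
  moreover have "(\<lambda>t. f (c + of_real r * cis t) / (c + of_real r * cis t - c) * of_real r * \<i> * cis t)
      = (\<lambda>t. \<i> * f (c + of_real r * cis t))"
    using assms(2) by (simp add: field_simps)
  ultimately have "((\<lambda>t. \<i> * f (c + of_real r * cis t)) has_integral (2 * of_real pi * \<i> * f c)) {0..2*pi}"
    by (simp only:)
  from has_integral_mult_right[OF this, of "-\<i>"]
  have "((\<lambda>t. f (c + of_real r * cis t)) has_integral (- \<i> * (2 * of_real pi * \<i> * f c))) {0..2*pi}"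
    by simp
  moreover have "- \<i> * (2 * of_real pi * \<i> * f c) = of_real (2*pi) * f c"
    by (simp add: algebra_simps)
  ultimately show ?thesis by (simp only:)
qed

lemma circle_mean_ln_norm:
  assumes "0 \<le> r" and "r < norm a"
  shows "((\<lambda>t. ln (norm (a + of_real r * cis t))) has_integral (2*pi * ln (norm a))) {0..2*pi}"
proof (cases "r = 0")
  case True
  then show ?thesis using has_integral_const_real[of "ln (norm a)" 0 "2*pi"] by simp
next
  case False
  then have r: "0 < r" using assms by simp
  have a: "a \<noteq> 0" using assms by auto
  have half: "1 + w / a \<notin> \<real>\<^sub>\<le>\<^sub>0" if "norm w \<le> r" for w
  proof -
    have "norm (w / a) < 1" using that assms a by (simp add: norm_divide divide_less_eq)
    then have "- 1 < Re (w / a)" using abs_Re_le_cmod[of "w/a"] by linarith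
    then have "0 < Re (1 + w / a)" by simp
    then show ?thesis using complex_nonpos_Reals_iff[of "1 + w/a"] by auto
  qed
  have "(\<lambda>w. Ln (1 + w / a)) holomorphic_on cball 0 r"
    by (intro holomorphic_intros) (use half a in auto)
  from has_integral_Re[OF holomorphic_circle_mean[OF this r]]
  have *: "((\<lambda>t. Re (Ln (1 + of_real r * cis t / a))) has_integral 0) {0..2*pi}"
    by simp
  have "ln (norm (a + of_real r * cis t)) = ln (norm a) + Re (Ln (1 + of_real r * cis t / a))" for t
  proof -
    have nz: "1 + of_real r * cis t / a \<noteq> 0"
      using half[of "of_real r * cis t"] r by (auto simp: norm_mult)
    have "a + of_real r * cis t = a * (1 + of_real r * cis t / a)"
      using a by (simp add: field_simps)
    then have "ln (norm (a + of_real r * cis t)) = ln (norm a * norm (1 + of_real r * cis t / a))"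
      by (simp add: norm_mult)
    then show ?thesis using a nz by (simp add: ln_mult)
  qed
  with has_integral_add[OF has_integral_const_real[of "ln (norm a)" 0 "2*pi"] *]
  show ?thesis by simp
qed

text \<open>
  With \<open>n = 1\<close> and \<open>b = r\<close> the mean of \<open>\<bar>\<zeta>\<bar>\<^sup>2\<close> over a circle of radius \<open>r\<close> exceeds the central value by
  \<open>r\<^sup>2\<close>; with \<open>n = 2\<close> and \<open>b\<close> of size \<open>r\<^sup>2\<close> the excess is only of order \<open>r\<^sup>4\<close>.
\<close>
lemma circle_mean_norm_sq:
  fixes a b :: complex
  assumes "0 < n"
  shows "((\<lambda>t. (norm (a + b * cis t ^ n))\<^sup>2) has_integral (2*pi * ((norm a)\<^sup>2 + (norm b)\<^sup>2))) {0..2*pi}"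
proof -
  have "(\<lambda>w. 2 * cnj a * b * w ^ n) holomorphic_on cball 0 1"
    by (intro holomorphic_intros)
  from has_integral_Re[OF holomorphic_circle_mean[OF this]]
  have *: "((\<lambda>t. Re (2 * cnj a * b * cis t ^ n)) has_integral 0) {0..2*pi}"
    using assms by (simp add: power_0_left del: times_complex.sel)
  have "(norm (a + b * cis t ^ n))\<^sup>2 = ((norm a)\<^sup>2 + (norm b)\<^sup>2) + Re (2 * cnj a * b * cis t ^ n)" for t
  proof -
    have "(norm (b * cis t ^ n))\<^sup>2 = (norm b)\<^sup>2" by (simp add: norm_mult norm_power)
    moreover have "(norm (x + y))\<^sup>2 = (norm x)\<^sup>2 + (norm y)\<^sup>2 + Re (2 * cnj x * y)" for x y
      unfolding cmod_power2 by (simp add: power2_eq_square algebra_simps)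
    ultimately show ?thesis by (simp add: mult.assoc)
  qed
  with has_integral_add[OF has_integral_const_real[of "(norm a)\<^sup>2 + (norm b)\<^sup>2" 0 "2*pi"] *]
  show ?thesis by simp
qed

lemma nn_integral_eq_integral_Icc:
  fixes g :: "real \<Rightarrow> real"
  assumes "continuous_on {a..b} g" and "\<And>t. t \<in> {a..b} \<Longrightarrow> 0 \<le> g t"
  shows "(\<integral>\<^sup>+t\<in>{a..b}. ennreal (g t) \<partial>lborel) = ennreal (integral {a..b} g)"
proof -
  have "set_integrable lborel {a..b} g"
    using assms(1) by (intro borel_integrable_atLeastAtMost') auto
  then have "(\<integral>\<^sup>+t\<in>{a..b}. ennreal (g t) \<partial>lborel) = ennreal (LINT t:{a..b}|lborel. g t)"
    unfolding set_integrable_def set_lebesgue_integral_def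
    by (subst nn_integral_eq_integral[symmetric])
       (use assms(2) in \<open>auto intro!: nn_integral_cong simp: indicator_def\<close>)
  also have "(LINT t:{a..b}|lborel. g t) = integral {a..b} g"
    using \<open>set_integrable lborel {a..b} g\<close> by (rule set_borel_integral_eq_integral)
  finally show ?thesis .
qed

text \<open>
  The shape in which subharmonicity is exploited: a continuous real majorant \<open>T\<close> on the circle
  replaces the two extended integrals of \<open>circle_mean\<close> by one ordinary integral.
\<close>
lemma circle_mean_le:
  assumes "continuous_on {0..2*pi} T" and "(T has_integral J) {0..2*pi}"
    and "\<And>t. t \<in> {0..2*pi} \<Longrightarrow> u (c + of_real r * cis t) \<le> ereal (T t)"
  shows "circle_mean u c r \<le> ereal (J / (2*pi))"
proof -
  let ?P = "integral {0..2*pi} (\<lambda>t. max 0 (T t))"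
  let ?N = "integral {0..2*pi} (\<lambda>t. max 0 (- T t))"
  have cP: "continuous_on {0..2*pi} (\<lambda>t. max 0 (T t))" and cN: "continuous_on {0..2*pi} (\<lambda>t. max 0 (- T t))"
    by (intro continuous_intros assms(1))+
  have "((\<lambda>t. max 0 (T t) - max 0 (- T t)) has_integral (?P - ?N)) {0..2*pi}"
    by (intro has_integral_diff integrable_integral integrable_continuous_real cP cN)
  moreover have "(\<lambda>t. max 0 (T t) - max 0 (- T t)) = T" by auto
  ultimately have J: "J = ?P - ?N" using assms(2) has_integral_unique by metis
  have PN: "0 \<le> ?P" "0 \<le> ?N"
    by (intro integral_nonneg integrable_continuous_real cP cN; simp)+
  have pos: "ennreal (max 0 x) = ennreal x" for x by (simp add: max_def ennreal_neg)
  have "(\<integral>\<^sup>+t\<in>{0..2*pi}. e2ennreal (u (c + of_real r * cis t)) \<partial>lborel)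
     \<le> (\<integral>\<^sup>+t\<in>{0..2*pi}. ennreal (max 0 (T t)) \<partial>lborel)"
  proof (intro nn_integral_mono)
    fix t
    have "e2ennreal (u (c + of_real r * cis t)) \<le> ennreal (max 0 (T t))" if "t \<in> {0..2*pi}"
      using e2ennreal_mono[OF assms(3)[OF that]] pos by simp
    then show "e2ennreal (u (c + of_real r * cis t)) * indicator {0..2*pi} t
        \<le> ennreal (max 0 (T t)) * indicator {0..2*pi} t"
      by (simp add: indicator_def)
  qed
  also have "\<dots> = ennreal ?P" by (rule nn_integral_eq_integral_Icc[OF cP]) simp
  finally have 1: "enn2ereal (\<integral>\<^sup>+t\<in>{0..2*pi}. e2ennreal (u (c + of_real r * cis t)) \<partial>lborel) \<le> ereal ?P"
    using PN by (simp add: less_eq_ennreal.rep_eq)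
  have "ennreal ?N = (\<integral>\<^sup>+t\<in>{0..2*pi}. ennreal (max 0 (- T t)) \<partial>lborel)"
    by (rule nn_integral_eq_integral_Icc[OF cN, symmetric]) simp
  also have "\<dots> \<le> (\<integral>\<^sup>+t\<in>{0..2*pi}. e2ennreal (- u (c + of_real r * cis t)) \<partial>lborel)"
  proof (intro nn_integral_mono)
    fix t
    have "ennreal (max 0 (- T t)) \<le> e2ennreal (- u (c + of_real r * cis t))" if "t \<in> {0..2*pi}"
    proof -
      have "- u (c + of_real r * cis t) \<ge> ereal (- T t)"
        using assms(3)[OF that] by (metis ereal_minus_le_minus uminus_ereal.simps(1))
      from e2ennreal_mono[OF this] show ?thesis
        using pos by simp
    qed
    then show "ennreal (max 0 (- T t)) * indicator {0..2*pi} t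
        \<le> e2ennreal (- u (c + of_real r * cis t)) * indicator {0..2*pi} t"
      by (simp add: indicator_def)
  qed
  finally have 2: "ereal ?N \<le> enn2ereal (\<integral>\<^sup>+t\<in>{0..2*pi}. e2ennreal (- u (c + of_real r * cis t)) \<partial>lborel)"
    using PN by (simp add: less_eq_ennreal.rep_eq)
  have "circle_mean u c r \<le> (ereal ?P - ereal ?N) / ereal (2*pi)"
    unfolding circle_mean_def by (intro ereal_divide_right_mono ereal_minus_mono 1 2) auto
  then show ?thesis using J by simp
qed

text \<open>
  Jensen's inequality. Splitting off linear factors reduces it to \<open>ln \<bar>\<zeta> - a\<bar>\<close>, which has mean
  value \<open>ln \<bar>c - a\<bar>\<close> if \<open>a\<close> lies outside the circle and \<open>ln r > ln \<bar>c - a\<bar>\<close> if it lies inside.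
\<close>
lemma ln_poly_circle_mean:
  fixes p :: "complex poly"
  assumes "0 < r" and "poly p c \<noteq> 0" and "\<And>t. poly p (c + of_real r * cis t) \<noteq> 0"
  shows "continuous_on {0..2*pi} (\<lambda>t. ln (norm (poly p (c + of_real r * cis t)))) \<and>
    2*pi * ln (norm (poly p c)) \<le> integral {0..2*pi} (\<lambda>t. ln (norm (poly p (c + of_real r * cis t))))"
  using assms(2,3)
proof (induction "degree p" arbitrary: p)
  case 0
  then obtain k where "p = [:k:]" by (metis degree_eq_zeroE)
  then show ?case by simp
next
  case (Suc n)
  then obtain a where a: "poly p a = 0"
    using fundamental_theorem_of_algebra[of p] constant_degree[of p] by auto
  then obtain q where p: "p = [:-a,1:] * q" using poly_eq_0_iff_dvd dvdE by metis
  have q0: "q \<noteq> 0" using Suc.hyps(2) p by auto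
  have deg: "n = degree q" using Suc.hyps(2) p q0 by (simp add: degree_mult_eq del: mult_pCons_left)
  have nz: "poly q c \<noteq> 0" "\<And>t. poly q (c + of_real r * cis t) \<noteq> 0" "c \<noteq> a"
    "\<And>t. c + of_real r * cis t \<noteq> a"
    using Suc.prems p by auto
  let ?l = "\<lambda>t. ln (norm (c - a + of_real r * cis t))"
  let ?m = "\<lambda>t. ln (norm (poly q (c + of_real r * cis t)))"
  note IH = Suc.hyps(1)[OF deg nz(1) nz(2)]
  have nz': "c - a + of_real r * cis t \<noteq> 0" for t using nz(4)[of t] by (simp add: algebra_simps)
  have split: "ln (norm (poly p (c + of_real r * cis t))) = ?l t + ?m t" for t
  proof -
    have "poly p (c + of_real r * cis t) = (c - a + of_real r * cis t) * poly q (c + of_real r * cis t)"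
      unfolding p by (simp add: algebra_simps)
    then show ?thesis using nz(2)[of t] nz'[of t] by (simp add: norm_mult ln_mult)
  qed
  have cl: "continuous_on {0..2*pi} ?l" 
    by (intro continuous_intros ballI) (use nz' in auto)
  have "2*pi * ln (norm (c - a)) \<le> integral {0..2*pi} ?l"
  proof (cases "r < norm (c - a)")
    case True
    then show ?thesis using circle_mean_ln_norm[of r "c - a"] assms(1) by (simp add: integral_unique)
  next
    case False
    \<comment> \<open>Reflection in the circle: unlike \<open>c - a + r w\<close>, the right-hand factor \<open>r + cnj (c - a) w\<close> has no
      zero in the closed unit disk, so its logarithm is holomorphic there.\<close>
    have refl: "norm (c - a + of_real r * cis t) = norm (of_real r + cnj (c - a) * cis t)" for t
    proof -
      have "norm (c - a + of_real r * cis t) = norm (cnj (c - a + of_real r * cis t) * cis t)"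
        by (simp only: norm_mult complex_mod_cnj norm_cis mult_1_right)
      also have "cnj (c - a + of_real r * cis t) * cis t = of_real r + cnj (c - a) * cis t"
        by (simp add: algebra_simps cis_cnj cis_mult)
      finally show ?thesis .
    qed
    have "norm (c - a) \<noteq> r"
    proof
      assume *: "norm (c - a) = r"
      have "a = c + of_real r * cis (Arg (a - c))"
        using * rcis_cmod_Arg[of "a - c"] by (simp add: rcis_def norm_minus_commute algebra_simps)
      then show False using nz(4) by metis
    qed
    then have lt: "norm (c - a) < r" using False by simp
    define b where "b = cnj (c - a)"
    have lt': "norm b < r" using lt by (simp add: b_def del: complex_cnj_diff)
    have "(\<lambda>w. Ln (of_real r + b * w)) holomorphic_on cball 0 1"
    proof (intro holomorphic_intros)
      fix w :: complex assume "w \<in> cball 0 1"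
      then have "norm (b * w) \<le> norm b" by (simp add: norm_mult mult_left_le)
      then have "- r < Re (b * w)" using lt' abs_Re_le_cmod[of "b * w"] by linarith
      then show "of_real r + b * w \<notin> \<real>\<^sub>\<le>\<^sub>0" by (auto simp: complex_nonpos_Reals_iff)
    qed
    from has_integral_Re[OF holomorphic_circle_mean[OF this]]
    have "((\<lambda>t. Re (Ln (of_real r + b * cis t))) has_integral (2*pi * ln r)) {0..2*pi}"
      using assms(1) by (simp add: Ln_of_real)
    moreover have "Re (Ln (of_real r + b * cis t)) = ?l t" for t
      using nz'[of t] refl[of t] by (subst Re_Ln) (auto simp: b_def)
    ultimately have "integral {0..2*pi} ?l = 2*pi * ln r"
      by (simp add: integral_unique)
    moreover have "ln (norm (c - a)) \<le> ln r"
      using lt nz(3) assms(1) by (subst ln_le_cancel_iff) auto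
    ultimately show ?thesis by simp
  qed
  moreover have "integral {0..2*pi} (\<lambda>t. ?l t + ?m t) = integral {0..2*pi} ?l + integral {0..2*pi} ?m"
    by (intro integral_add integrable_continuous_real cl conjunct1[OF IH])
  moreover have "ln (norm (poly p c)) = ln (norm (c - a)) + ln (norm (poly q c))"
  proof -
    have "poly p c = (c - a) * poly q c" unfolding p by (simp add: algebra_simps)
    then show ?thesis using nz by (simp add: norm_mult ln_mult)
  qed
  ultimately show ?case
    unfolding split using IH cl by (simp add: continuous_on_add distrib_left)
qed

section \<open>Upper semicontinuous functions on compact sets\<close>

lemma usc_on_iff_eventually:
  "usc_on \<Omega> u \<longleftrightarrow> (\<forall>x\<in>\<Omega>. \<forall>c. u x < c \<longrightarrow> (\<forall>\<^sub>F y in at x within \<Omega>. u y < c))"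
proof
  assume *: "usc_on \<Omega> u"
  show "\<forall>x\<in>\<Omega>. \<forall>c. u x < c \<longrightarrow> (\<forall>\<^sub>F y in at x within \<Omega>. u y < c)"
  proof (intro ballI allI impI)
    fix x c assume x: "x \<in> \<Omega>" "u x < c"
    obtain T where "open T" "{y \<in> \<Omega>. u y < c} = \<Omega> \<inter> T"
      using * unfolding usc_on_def openin_open by metis
    then show "\<forall>\<^sub>F y in at x within \<Omega>. u y < c"
      unfolding eventually_at_topological using x by (intro exI[of _ T]) auto
  qed
next
  assume *: "\<forall>x\<in>\<Omega>. \<forall>c. u x < c \<longrightarrow> (\<forall>\<^sub>F y in at x within \<Omega>. u y < c)"
  show "usc_on \<Omega> u"
    unfolding usc_on_def
  proof
    fix c
    show "openin (top_of_set \<Omega>) {x \<in> \<Omega>. u x < c}"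
    proof (subst openin_subopen, intro ballI)
      fix x assume x: "x \<in> {x \<in> \<Omega>. u x < c}"
      then have "\<forall>\<^sub>F y in at x within \<Omega>. u y < c" using * by simp
      then obtain T where T: "open T" "x \<in> T" "\<forall>y\<in>T. y \<noteq> x \<longrightarrow> y \<in> \<Omega> \<longrightarrow> u y < c"
        unfolding eventually_at_topological by auto
      show "\<exists>U. openin (top_of_set \<Omega>) U \<and> x \<in> U \<and> U \<subseteq> {x \<in> \<Omega>. u x < c}"
        using T x by (intro exI[of _ "\<Omega> \<inter> T"]) (auto simp: openin_open)
    qed
  qed
qed

lemma usc_on_subset: "usc_on \<Omega> u \<Longrightarrow> C \<subseteq> \<Omega> \<Longrightarrow> usc_on C u"
  unfolding usc_on_iff_eventually
proof (intro ballI allI impI)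
  fix x c
  assume *: "\<forall>x\<in>\<Omega>. \<forall>c. u x < c \<longrightarrow> (\<forall>\<^sub>F y in at x within \<Omega>. u y < c)" and C: "C \<subseteq> \<Omega>"
    and x: "x \<in> C" "u x < c"
  then have "\<forall>\<^sub>F y in at x within \<Omega>. u y < c" by auto
  then show "\<forall>\<^sub>F y in at x within C. u y < c" by (rule filter_leD[OF at_le[OF C]])
qed

lemma usc_on_minus_continuous:
  fixes u :: "'a::topological_space \<Rightarrow> ereal"
  assumes "usc_on C u" and "\<And>x. x \<in> C \<Longrightarrow> u x < \<infinity>" and "continuous_on C q"
  shows "usc_on C (\<lambda>x. u x - ereal (q x))"
  unfolding usc_on_iff_eventually
proof (intro ballI allI impI)
  fix x c assume x: "x \<in> C" and c: "u x - ereal (q x) < c"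
  have "u x < c + ereal (q x)"
    using c by (cases "u x"; cases c) auto
  then obtain d where d: "u x < ereal d" "ereal d < c + ereal (q x)"
    using ereal_dense2 by blast
  then have "ereal (d - q x) < c" by (cases c) auto
  moreover have "((\<lambda>y. ereal (d - q y)) \<longlongrightarrow> ereal (d - q x)) (at x within C)"
    using assms(3) x by (intro tendsto_intros) (auto simp: continuous_on_def)
  ultimately have "\<forall>\<^sub>F y in at x within C. ereal (d - q y) < c"
    by (rule order_tendstoD(2)[rotated])
  moreover have "\<forall>\<^sub>F y in at x within C. u y < ereal d"
    using assms(1) x d unfolding usc_on_iff_eventually by blast
  ultimately show "\<forall>\<^sub>F y in at x within C. u y - ereal (q y) < c"
  proof eventually_elim
    case (elim y)
    have "u y - ereal (q y) \<le> ereal (d - q y)"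
      using elim(2) by (cases "u y") auto
    then show ?case using elim(1) by order
  qed
qed

lemma usc_on_compact_attains_max:
  assumes "usc_on C f" and "compact C" and "C \<noteq> {}"
  obtains x where "x \<in> C" and "\<And>y. y \<in> C \<Longrightarrow> f y \<le> f x"
proof -
  have "\<exists>x\<in>C. \<forall>y\<in>C. f y \<le> f x"
  proof (rule ccontr)
    assume "\<not> ?thesis"
    then have ex: "\<forall>x\<in>C. \<exists>y\<in>C. f x < f y" by (auto simp: not_le)
    let ?U = "\<lambda>y. {x \<in> C. f x < f y}"
    have "\<forall>c\<in>?U ` C. openin (top_of_set C) c" using assms(1) unfolding usc_on_def by auto
    moreover have "C \<subseteq> \<Union>(?U ` C)" using ex by blast
    ultimately have "\<exists>D\<subseteq>?U ` C. finite D \<and> C \<subseteq> \<Union>D"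
      using assms(2) unfolding compact_eq_openin_cover by simp
    then obtain D where D: "D \<subseteq> ?U ` C" "finite D" "C \<subseteq> \<Union>D" by (elim exE conjE)
    from finite_subset_image[OF D(2,1)] obtain F where "F \<subseteq> C" "finite F" "D = ?U ` F"
      by (elim exE conjE)
    then have F: "F \<subseteq> C" "finite F" "C \<subseteq> \<Union>(?U ` F)" using D(3) by simp_all
    have "F \<noteq> {}" using F(3) assms(3) by auto
    then have "Max (f ` F) \<in> f ` F" using F(2) by (intro Max_in) auto
    then obtain y where y: "y \<in> F" "f y = Max (f ` F)" by (metis imageE)
    then obtain y' where "y' \<in> F" "f y < f y'" using F by blast
    moreover have "f y' \<le> f y" using y(2) F(2) \<open>y' \<in> F\<close> by simp
    ultimately show False by order
  qed
  then show ?thesis using that by blast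
qed

text \<open>
  The sets \<open>{f < n d}\<close> grow with \<open>n\<close>, are relatively open and cover \<open>B\<close>, so one of them is all of \<open>B\<close>:
  a large multiple of \<open>d\<close> extends negativity of \<open>f\<close> from the zero set of \<open>d\<close> to \<open>B\<close>.
\<close>
lemma usc_on_compact_penalty:
  fixes d :: "'a::topological_space \<Rightarrow> real"
  assumes "usc_on B f" and "\<And>x. x \<in> B \<Longrightarrow> f x < \<infinity>" and "compact B" and "continuous_on B d"
    and "\<And>x. x \<in> B \<Longrightarrow> 0 \<le> d x" and "\<And>x. x \<in> B \<Longrightarrow> d x = 0 \<Longrightarrow> f x < 0"
  obtains n :: nat where "\<And>x. x \<in> B \<Longrightarrow> f x - ereal (real n * d x) < 0"
proof -
  let ?U = "\<lambda>n::nat. {x \<in> B. f x - ereal (real n * d x) < 0}"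
  have "usc_on B (\<lambda>x. f x - ereal (real n * d x))" for n :: nat
    by (intro usc_on_minus_continuous continuous_intros assms) auto
  then have "\<forall>c\<in>range ?U. openin (top_of_set B) c" unfolding usc_on_def by auto
  moreover have "B \<subseteq> \<Union>(range ?U)"
  proof
    fix x assume x: "x \<in> B"
    have "\<exists>n::nat. f x - ereal (real n * d x) < 0"
    proof (cases "d x = 0")
      case True
      then show ?thesis using assms(6)[OF x] by (simp add: zero_ereal_def[symmetric])
    next
      case False
      then have pos: "0 < d x" using assms(5)[OF x] by simp
      show ?thesis
      proof (cases "f x")
        case (real y)
        obtain n :: nat where "y / d x < n" using reals_Archimedean2 by blast
        then have "y < real n * d x" using pos by (simp add: field_simps)
        then show ?thesis using real by auto
      qed (use assms(2)[OF x] in auto)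
    qed
    then show "x \<in> \<Union>(range ?U)" using x by blast
  qed
  ultimately have "\<exists>D\<subseteq>range ?U. finite D \<and> B \<subseteq> \<Union>D"
    using assms(3) unfolding compact_eq_openin_cover by simp
  then obtain D where D: "D \<subseteq> range ?U" "finite D" "B \<subseteq> \<Union>D" by (elim exE conjE)
  from finite_subset_image[OF D(2,1)] obtain F where "finite F" "D = ?U ` F"
    by (elim exE conjE)
  then have F: "finite F" "B \<subseteq> \<Union>(?U ` F)" using D(3) by simp_all
  show ?thesis
  proof (rule that)
    fix x assume x: "x \<in> B"
    then obtain n where n: "n \<in> F" "f x - ereal (real n * d x) < 0" using F by blast
    have "real n * d x \<le> Max F * d x"
      using n(1) F(1) assms(5)[OF x] by (intro mult_right_mono) auto
    then have "f x - ereal (real (Max F) * d x) \<le> f x - ereal (real n * d x)"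
      by (intro ereal_minus_mono) auto
    then show "f x - ereal (real (Max F) * d x) < 0" using n(2) by order
  qed
qed

section \<open>Plurisubharmonic functions along a parabola\<close>

lemma psh_on_line_submean:
  assumes "psh_on \<Omega> u" and "0 < r"
    and "\<And>\<tau>. norm \<tau> \<le> r \<Longrightarrow> (p1 + \<tau>, p2 + \<tau> * b) \<in> \<Omega>"
    and "continuous_on {0..2*pi} T" and "(T has_integral (2*pi*J)) {0..2*pi}"
    and "\<And>t. u (p1 + of_real r * cis t, p2 + of_real r * cis t * b) \<le> ereal (T t)"
  shows "u (p1, p2) \<le> ereal J"
proof -
  let ?v = "\<lambda>\<zeta>. u (p1 + \<zeta> * 1, p2 + \<zeta> * b)"
  have "subharmonic_on {\<zeta>. (p1 + \<zeta> * 1, p2 + \<zeta> * b) \<in> \<Omega>} ?v"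
  proof -
    have "(1::complex, b) \<noteq> (0, 0)" by simp
    then show ?thesis using assms(1) unfolding psh_on_def by blast
  qed
  moreover have "cball 0 r \<subseteq> {\<zeta>. (p1 + \<zeta> * 1, p2 + \<zeta> * b) \<in> \<Omega>}"
    using assms(3) by auto
  ultimately have "?v 0 \<le> circle_mean ?v 0 r"
    using assms(2) unfolding subharmonic_on_def by blast
  also have "\<dots> \<le> ereal (2*pi*J / (2*pi))"
    by (rule circle_mean_le[OF assms(4,5)]) (use assms(6) in auto)
  finally show ?thesis by simp
qed

text \<open>
  A maximum principle for a plurisubharmonic \<open>u\<close> along the curve \<open>w = g \<zeta>\<close>, although
  subharmonicity is only known along straight lines. If \<open>u - q\<close> were positive somewhere on the curve,
  then so would be the maximum of \<open>u - q - n \<bar>w - g \<zeta>\<bar>\<^sup>2\<close> over a compact set around the curve, and for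
  large \<open>n\<close> it would be attained in the interior. There, on the complex line with the slope
  \<open>g' \<zeta>\<close>, the penalty is \<open>n \<bar>h - \<kappa> \<tau>\<^sup>2\<bar>\<^sup>2\<close> with a constant \<open>h\<close>, whose circular mean exceeds its central value by
  \<open>n \<bar>\<kappa>\<bar>\<^sup>2 r\<^sup>4\<close> only. For small \<open>r\<close> this is less than the deficit \<open>\<eta> r\<^sup>2\<close> of \<open>q\<close>, against the
  sub-mean value property of \<open>u\<close>.
\<close>
lemma psh_parabola_max_principle:
  fixes u :: "complex \<times> complex \<Rightarrow> ereal" and \<kappa> e :: complex
  defines "g \<equiv> \<lambda>\<zeta>. \<kappa> * \<zeta> * (\<zeta> - e)"
  assumes u: "u \<in> PSH_minus"
    and A: "compact A" "O' \<subseteq> A" "open O'" "A \<subseteq> ball 0 1"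
    and g: "\<And>\<zeta>. \<zeta> \<in> A \<Longrightarrow> norm (g \<zeta>) < 1"
    and q: "continuous_on A q" "0 < \<eta>"
    and mean: "\<And>\<zeta>. \<zeta> \<in> O' \<Longrightarrow> \<forall>\<^sub>F r in at_right 0.
        ((\<lambda>t. q (\<zeta> + of_real r * cis t)) has_integral (2*pi * (q \<zeta> - \<eta> * r\<^sup>2))) {0..2*pi}"
    and bdry: "\<And>\<zeta>. \<zeta> \<in> A - O' \<Longrightarrow> u (\<zeta>, g \<zeta>) < ereal (q \<zeta>)"
    and z: "z \<in> A"
  shows "u (z, g z) \<le> ereal (q z)"
proof (rule ccontr)
  assume "\<not> ?thesis"
  then have z_gt: "ereal (q z) < u (z, g z)" by simp
  have psh: "psh_on bidisk u" and neg: "\<And>p. p \<in> bidisk \<Longrightarrow> u p \<le> 0"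
    using u unfolding PSH_minus_def by auto
  have cg: "continuous_on A g" unfolding g_def by (intro continuous_intros)
  obtain R where R: "\<And>\<zeta>. \<zeta> \<in> A \<Longrightarrow> norm (g \<zeta>) < R" "R < 1"
  proof -
    have "continuous_on A (\<lambda>\<zeta>. norm (g \<zeta>))" by (intro continuous_intros cg)
    from continuous_attains_sup[OF A(1) _ this] z
    obtain x where x: "x \<in> A" "\<And>y. y \<in> A \<Longrightarrow> norm (g y) \<le> norm (g x)" by blast
    obtain R where "norm (g x) < R" "R < 1" using dense g[OF x(1)] by blast
    then show ?thesis using x that by (meson le_less_trans)
  qed
  let ?C = "A \<times> cball (0::complex) R"
  define B where "B = ?C - O' \<times> ball 0 R"
  define d where "d = (\<lambda>p. (norm (snd p - g (fst p)))\<^sup>2)"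
  define f where "f = (\<lambda>p. u p - ereal (q (fst p)))"
  have CD: "?C \<subseteq> bidisk" using A(4) R(2) unfolding bidisk_def by auto
  have cC: "compact ?C" by (intro compact_Times A compact_cball)
  have cqC: "continuous_on ?C (\<lambda>p. q (fst p))"
    by (rule continuous_on_compose2[OF q(1)]) (auto intro!: continuous_intros)
  have cdC: "continuous_on ?C d"
    unfolding d_def by (intro continuous_intros continuous_on_compose2[OF cg]) auto
  have uC: "usc_on ?C u" using psh CD unfolding psh_on_def by (blast intro: usc_on_subset)
  have u_fin: "u p < \<infinity>" if "p \<in> ?C" for p using neg[of p] that CD by auto
  have f_fin: "f p < \<infinity>" if "p \<in> ?C" for p
    using u_fin[OF that] unfolding f_def by (cases "u p") auto
  have fC: "usc_on ?C f"
    unfolding f_def by (intro usc_on_minus_continuous uC cqC u_fin)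
  have "compact B"
    unfolding B_def by (intro compact_diff cC open_Times A open_ball)
  have BC: "B \<subseteq> ?C" unfolding B_def by blast
  have on_curve: "f p < 0" if p: "p \<in> B" "d p = 0" for p
  proof -
    obtain \<zeta> where \<zeta>: "p = (\<zeta>, g \<zeta>)" using p(2) unfolding d_def by (cases p) auto
    then have "\<zeta> \<in> A - O'" using p(1) R(1) unfolding B_def by auto
    from bdry[OF this] show ?thesis unfolding f_def \<zeta> by (cases "u (\<zeta>, g \<zeta>)") auto
  qed
  obtain n :: nat where n: "\<And>p. p \<in> B \<Longrightarrow> f p - ereal (real n * d p) < 0"
    by (rule usc_on_compact_penalty[of B f d])
       (use fC f_fin BC \<open>compact B\<close> cdC on_curve in
         \<open>auto intro: usc_on_subset continuous_on_subset simp: d_def\<close>)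
  have "usc_on ?C (\<lambda>p. f p - ereal (real n * d p))"
    by (intro usc_on_minus_continuous fC f_fin continuous_intros cdC)
  then obtain p where p: "p \<in> ?C" and max: "\<And>p'. p' \<in> ?C \<Longrightarrow> f p' - ereal (real n * d p') \<le> f p - ereal (real n * d p)"
    using usc_on_compact_attains_max[OF _ cC] z R(1)
    by (metis (no_types, lifting) SigmaI empty_iff less_imp_le mem_cball_0)
  have "(z, g z) \<in> ?C" using z R(1) by (auto intro: less_imp_le)
  have "0 < f (z, g z) - ereal (real n * d (z, g z))"
    using z_gt by (cases "u (z, g z)") (auto simp: f_def d_def)
  also note max[OF \<open>(z, g z) \<in> ?C\<close>]
  finally have max_pos: "0 < f p - ereal (real n * d p)" .
  then have "p \<notin> B" using n[of p] by auto
  then obtain \<zeta> w where pw: "p = (\<zeta>, w)" and \<zeta>: "\<zeta> \<in> O'" and w: "norm w < R"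
    using p unfolding B_def by auto
  obtain x where x: "u p = ereal x"
    using max_pos neg[of p] p CD unfolding f_def by (cases "u p") auto
  \<comment> \<open>the derivative of \<open>g\<close> at \<open>\<zeta>\<close>\<close>
  define b where "b = \<kappa> * (2 * \<zeta> - e)"
  have small: "\<forall>\<^sub>F r in at_right 0. norm w + r * norm b < R" "\<forall>\<^sub>F r in at_right 0. n * (norm \<kappa>)\<^sup>2 * r\<^sup>2 < \<eta>"
  proof -
    have "((\<lambda>r. norm w + r * norm b) \<longlongrightarrow> norm w + 0 * norm b) (at_right 0)"
      "((\<lambda>r. n * (norm \<kappa>)\<^sup>2 * r\<^sup>2) \<longlongrightarrow> n * (norm \<kappa>)\<^sup>2 * 0\<^sup>2) (at_right (0::real))"
      by (intro tendsto_intros)+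
    from order_tendstoD(2)[OF this(1), of R] order_tendstoD(2)[OF this(2), of \<eta>]
    show "\<forall>\<^sub>F r in at_right 0. norm w + r * norm b < R" "\<forall>\<^sub>F r in at_right 0. n * (norm \<kappa>)\<^sup>2 * r\<^sup>2 < \<eta>"
      using w q(2) by auto
  qed
  obtain \<rho> where \<rho>: "0 < \<rho>" "cball \<zeta> \<rho> \<subseteq> O'" using A(3) \<zeta> open_contains_cball by blast
  have "\<forall>\<^sub>F r in at_right (0::real). 0 < r \<and> r < \<rho>" 
    using eventually_at_right_real[OF \<rho>(1)] by simp
  from eventually_happens[OF eventually_conj[OF this eventually_conj[OF mean[OF \<zeta>] eventually_conj[OF small]]]]
  obtain r where r: "0 < r" "r < \<rho>" "norm w + r * norm b < R" "n * (norm \<kappa>)\<^sup>2 * r\<^sup>2 < \<eta>"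
    and mean_r: "((\<lambda>t. q (\<zeta> + of_real r * cis t)) has_integral (2*pi * (q \<zeta> - \<eta> * r\<^sup>2))) {0..2*pi}"
    by auto
  have line: "(\<zeta> + \<tau>, w + \<tau> * b) \<in> ?C" "\<zeta> + \<tau> \<in> A" if "norm \<tau> \<le> r" for \<tau>
  proof -
    have "\<zeta> + \<tau> \<in> cball \<zeta> \<rho>" using that r by (simp add: dist_norm)
    then show "\<zeta> + \<tau> \<in> A" using \<rho>(2) A(2) by blast
    have "norm (w + \<tau> * b) \<le> norm w + norm \<tau> * norm b" by (metis norm_mult norm_triangle_ineq)
    also have "\<dots> \<le> norm w + r * norm b" using that by (intro add_left_mono mult_right_mono) auto
    finally show "(\<zeta> + \<tau>, w + \<tau> * b) \<in> ?C" using \<open>\<zeta> + \<tau> \<in> A\<close> r(3) by auto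
  qed
  define h where "h = w - g \<zeta>"
  define m where "m = x - q \<zeta> - n * (norm h)\<^sup>2"
  define T where "T = (\<lambda>t. (m + q (\<zeta> + of_real r * cis t)) + n * (norm (h + (- \<kappa> * of_real r^2) * cis t ^ 2))\<^sup>2)"
  have T_bound: "u (\<zeta> + of_real r * cis t, w + of_real r * cis t * b) \<le> ereal (T t)" for t
  proof -
    define \<tau> where "\<tau> = of_real r * cis t"
    have "norm \<tau> \<le> r" using r(1) by (simp add: \<tau>_def norm_mult)
    from max[OF line(1)[OF this]]
    have "u (\<zeta> + \<tau>, w + \<tau> * b) - ereal (q (\<zeta> + \<tau>)) - ereal (real n * (norm (w + \<tau> * b - g (\<zeta> + \<tau>)))\<^sup>2) \<le> ereal m"
      unfolding f_def d_def pw x[unfolded pw] m_def h_def by simp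
    moreover have "w + \<tau> * b - g (\<zeta> + \<tau>) = h + (- \<kappa> * of_real r^2) * cis t ^ 2"
      unfolding g_def h_def b_def \<tau>_def by (simp add: power2_eq_square algebra_simps)
    ultimately have "u (\<zeta> + \<tau>, w + \<tau> * b) \<le> ereal (T t)"
      unfolding T_def \<tau>_def by (cases "u (\<zeta> + of_real r * cis t, w + of_real r * cis t * b)") auto
    then show ?thesis unfolding \<tau>_def .
  qed
  have "continuous_on {0..2*pi} (\<lambda>t. q (\<zeta> + of_real r * cis t))"
    by (rule continuous_on_compose2[OF q(1)]) (use line(2) r(1) in \<open>auto intro!: continuous_intros simp: norm_mult\<close>)
  then have contT: "continuous_on {0..2*pi} T"
    unfolding T_def by (intro continuous_intros)
  define J where "J = m + (q \<zeta> - \<eta> * r\<^sup>2) + n * ((norm h)\<^sup>2 + (norm \<kappa>)\<^sup>2 * (r\<^sup>2)\<^sup>2)"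
  have "(norm (- \<kappa> * of_real r^2))\<^sup>2 = (norm \<kappa>)\<^sup>2 * (r\<^sup>2)\<^sup>2"
    by (simp add: norm_mult norm_power power_mult_distrib)
  then have "((\<lambda>t. (norm (h + (- \<kappa> * of_real r^2) * cis t ^ 2))\<^sup>2)
      has_integral (2*pi * ((norm h)\<^sup>2 + (norm \<kappa>)\<^sup>2 * (r\<^sup>2)\<^sup>2))) {0..2*pi}"
    using circle_mean_norm_sq[of 2 h "- \<kappa> * of_real r^2"] by simp
  from has_integral_add[OF has_integral_add[OF has_integral_const_real[of m 0 "2*pi"] mean_r]
      has_integral_mult_right[OF this, of "real n"]]
  have "(T has_integral (2*pi*J)) {0..2*pi}"
    unfolding T_def J_def by (simp add: algebra_simps)
  from psh_on_line_submean[OF psh r(1) _ contT this T_bound] line(1) CD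
  have "u (\<zeta>, w) \<le> ereal J" by blast
  then have "x \<le> x - r\<^sup>2 * (\<eta> - n * (norm \<kappa>)\<^sup>2 * r\<^sup>2)"
    using x unfolding pw J_def m_def by (simp add: algebra_simps power2_eq_square)
  then show False using r by (auto simp: zero_less_mult_iff mult_le_0_iff dest: leD)
qed

lemma elog_mono: "0 \<le> x \<Longrightarrow> x \<le> y \<Longrightarrow> elog x \<le> elog y"
  unfolding elog_def by auto

text \<open>
  Near the pole \<open>a\<close>, \<open>u\<close> is at most \<open>ln \<bar>\<zeta> - a\<bar> + O(1)\<close> on the parabola, so weakening the coefficient
  of the logarithm to \<open>1 - \<eta>\<close> leaves room for any bounded perturbation \<open>k\<close>.
\<close>
lemma psh_parabola_near_pole:
  fixes a a' \<kappa> :: complex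
  assumes "log_pole_at u (a, 0)" and "a \<noteq> a'" and "0 < \<eta>"
    and "(k \<longlongrightarrow> l) (at a)"
  shows "\<forall>\<^sub>F \<zeta> in at a. u (\<zeta>, \<kappa> * (\<zeta> - a) * (\<zeta> - a')) < ereal ((1 - \<eta>) * ln (norm (\<zeta> - a)) + k \<zeta>)"
proof -
  let ?p = "\<lambda>\<zeta>. (\<zeta>, \<kappa> * (\<zeta> - a) * (\<zeta> - a'))"
  let ?s = "\<lambda>\<zeta>. 1 + norm \<kappa> * norm (\<zeta> - a')"
  obtain C where C: "\<forall>\<^sub>F w in at (a, 0). u w \<le> elog (norm (w - (a, 0))) + ereal C"
    using assms(1) unfolding log_pole_at_def by blast
  have "(?p \<longlongrightarrow> (a, \<kappa> * (a - a) * (a - a'))) (at a)" by (intro tendsto_intros)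
  then have "filterlim ?p (at (a, 0)) (at a)"
    by (auto simp: filterlim_at eventually_at intro!: exI[of _ 1])
  from filterlim_iff[THEN iffD1, OF this, rule_format, OF C]
  have C': "\<forall>\<^sub>F \<zeta> in at a. u (?p \<zeta>) \<le> elog (norm (?p \<zeta> - (a, 0))) + ereal C" .
  have "filterlim (\<lambda>\<zeta>. norm (\<zeta> - a)) (at_right 0) (at a)"
  proof -
    have "((\<lambda>\<zeta>. norm (\<zeta> - a)) \<longlongrightarrow> norm (a - a)) (at a)" by (intro tendsto_intros)
    then show ?thesis by (auto simp: filterlim_at eventually_at intro!: exI[of _ 1])
  qed
  then have "LIM \<zeta> at a. ln (norm (\<zeta> - a)) :> at_bot" by (rule filterlim_compose[OF ln_at_0])
  then have top: "LIM \<zeta> at a. - ln (norm (\<zeta> - a)) :> at_top"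
    by (simp add: filterlim_uminus_at_bot)
  have "LIM \<zeta> at a. \<eta> * (- ln (norm (\<zeta> - a))) :> at_top"
    by (rule filterlim_tendsto_pos_mult_at_top[OF tendsto_const assms(3) top])
  moreover have "((\<lambda>\<zeta>. k \<zeta> - ln (?s \<zeta>) - C) \<longlongrightarrow> l - ln (?s a) - C) (at a)"
    by (intro tendsto_intros assms(4)) (smt (verit) mult_nonneg_nonneg norm_ge_zero)
  ultimately have "LIM \<zeta> at a. (k \<zeta> - ln (?s \<zeta>) - C) + \<eta> * (- ln (norm (\<zeta> - a))) :> at_top"
    using filterlim_tendsto_add_at_top by blast
  then have "\<forall>\<^sub>F \<zeta> in at a. 0 < (k \<zeta> - ln (?s \<zeta>) - C) + \<eta> * (- ln (norm (\<zeta> - a)))"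
    unfolding filterlim_at_top_dense by blast
  moreover have "\<forall>\<^sub>F \<zeta> in at a. \<zeta> \<noteq> a" by (simp add: eventually_at_filter)
  ultimately show ?thesis using C'
  proof eventually_elim
    case (elim \<zeta>)
    have s: "0 < ?s \<zeta>" by (smt (verit) mult_nonneg_nonneg norm_ge_zero)
    have "norm (?p \<zeta> - (a, 0)) \<le> norm (\<zeta> - a) + norm (\<kappa> * (\<zeta> - a) * (\<zeta> - a'))"
      using norm_Pair_le[of "\<zeta> - a" "\<kappa> * (\<zeta> - a) * (\<zeta> - a')"] by simp
    also have "\<dots> = norm (\<zeta> - a) * ?s \<zeta>" by (simp add: norm_mult distrib_left mult_ac)
    finally have "elog (norm (?p \<zeta> - (a, 0))) \<le> elog (norm (\<zeta> - a) * ?s \<zeta>)"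
      by (intro elog_mono) auto
    also have "\<dots> = ereal (ln (norm (\<zeta> - a)) + ln (?s \<zeta>))"
      using s elim(2) by (auto simp: elog_def ln_mult)
    finally have "u (?p \<zeta>) \<le> ereal (ln (norm (\<zeta> - a)) + ln (?s \<zeta>)) + ereal C"
      using elim(3) by (meson add_right_mono order_trans)
    also have "\<dots> < ereal ((1 - \<eta>) * ln (norm (\<zeta> - a)) + k \<zeta>)"
      using elim(1) by (simp add: algebra_simps)
    finally show ?case .
  qed
qed

text \<open>
  The bound is a multiple-pole analogue of the Schwarz lemma on the disk of radius \<open>R\<close>: the
  right-hand side, as a function of \<open>z\<close>, is harmonic off the poles, has the same
  singularities there, and is nonnegative on the boundary circle.
\<close>
lemma psh_parabola_two_poles:
  fixes e \<kappa> z :: complex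
  assumes u: "u \<in> PSH_minus" and pole: "log_pole_at u (0, 0)" "log_pole_at u (e, 0)"
    and e: "e \<noteq> 0" "norm e < R" and R: "R < 1" "norm \<kappa> * (R * (R + norm e)) < 1"
    and z: "z \<noteq> 0" "z \<noteq> e" "norm z < R"
  shows "u (z, \<kappa> * z * (z - e)) \<le> ereal (ln (norm z) + ln (norm (z - e)) - ln (R * (R - norm e)))"
proof -
  define g where "g = (\<lambda>\<zeta>. \<kappa> * \<zeta> * (\<zeta> - e))"
  define L where "L = ln (R * (R - norm e))"
  \<comment> \<open>\<open>\<eta>\<close> weakens the poles, makes \<open>q\<close> strictly superharmonic and makes it positive on the circle
    of radius \<open>R\<close>; at the end it tends to \<open>0\<close>.\<close>
  define q where "q = (\<lambda>\<eta> \<zeta>. (1 - \<eta>) * (ln (norm \<zeta>) + ln (norm (\<zeta> - e)) - L) + \<eta> * (1 - (norm \<zeta>)\<^sup>2))"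
  have R0: "0 < R" using e(2) norm_ge_zero[of e] by linarith
  have g1: "norm (g \<zeta>) < 1" if "norm \<zeta> \<le> R" for \<zeta>
  proof -
    have "norm (g \<zeta>) = norm \<kappa> * (norm \<zeta> * norm (\<zeta> - e))" by (simp add: g_def norm_mult)
    also have "\<dots> \<le> norm \<kappa> * (R * (R + norm e))"
      using that norm_triangle_ineq4[of \<zeta> e] R0 by (intro mult_left_mono mult_mono) auto
    finally show ?thesis using R(2) by simp
  qed
  have key: "u (z, g z) \<le> ereal (q \<eta> z)" if \<eta>: "0 < \<eta>" "\<eta> < 1" for \<eta>
  proof -
    have "((\<lambda>\<zeta>. (1 - \<eta>) * (ln (norm (\<zeta> - e)) - L) + \<eta> * (1 - (norm \<zeta>)\<^sup>2))
        \<longlongrightarrow> (1 - \<eta>) * (ln (norm (0 - e)) - L) + \<eta> * (1 - (norm (0::complex))\<^sup>2)) (at 0)"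
      using e(1) by (intro tendsto_intros) auto
    from psh_parabola_near_pole[OF pole(1) e(1)[symmetric] \<eta>(1) this, of \<kappa>]
    have "\<forall>\<^sub>F \<zeta> in at 0. u (\<zeta>, g \<zeta>) < ereal (q \<eta> \<zeta>)"
      by (simp add: g_def q_def algebra_simps)
    then obtain s1 where s1: "0 < s1" "\<And>\<zeta>. \<zeta> \<noteq> 0 \<Longrightarrow> norm \<zeta> < s1 \<Longrightarrow> u (\<zeta>, g \<zeta>) < ereal (q \<eta> \<zeta>)"
      unfolding eventually_at by auto
    have "((\<lambda>\<zeta>. (1 - \<eta>) * (ln (norm \<zeta>) - L) + \<eta> * (1 - (norm \<zeta>)\<^sup>2))
        \<longlongrightarrow> (1 - \<eta>) * (ln (norm e) - L) + \<eta> * (1 - (norm e)\<^sup>2)) (at e)"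
      using e(1) by (intro tendsto_intros) auto
    from psh_parabola_near_pole[OF pole(2) e(1) \<eta>(1) this, of \<kappa>]
    have "\<forall>\<^sub>F \<zeta> in at e. u (\<zeta>, g \<zeta>) < ereal (q \<eta> \<zeta>)"
      by (simp add: g_def q_def algebra_simps)
    then obtain s2 where s2: "0 < s2" "\<And>\<zeta>. \<zeta> \<noteq> e \<Longrightarrow> norm (\<zeta> - e) < s2 \<Longrightarrow> u (\<zeta>, g \<zeta>) < ereal (q \<eta> \<zeta>)"
      unfolding eventually_at by (auto simp: dist_norm)
    define s where "s = Min {s1/2, s2/2, norm z, norm (z - e)}"
    have s: "0 < s" "s < s1" "s < s2" "s \<le> norm z" "s \<le> norm (z - e)"
      using s1(1) s2(1) z unfolding s_def by auto
    define A where "A = {\<zeta>. norm \<zeta> \<le> R \<and> s \<le> norm \<zeta> \<and> s \<le> norm (\<zeta> - e)}"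
    define O' where "O' = {\<zeta>. norm \<zeta> < R \<and> s < norm \<zeta> \<and> s < norm (\<zeta> - e)}"
    have nz: "\<zeta> \<noteq> 0" "\<zeta> \<noteq> e" if "\<zeta> \<in> A" for \<zeta> using that s(1) by (auto simp: A_def)
    have "A = cball 0 R \<inter> {\<zeta>. s \<le> norm \<zeta> \<and> s \<le> norm (\<zeta> - e)}" by (auto simp: A_def)
    moreover have "closed {\<zeta>. s \<le> norm \<zeta> \<and> s \<le> norm (\<zeta> - e)}"
      by (intro closed_Collect_conj closed_Collect_le continuous_intros)
    ultimately have cA: "compact A" by (simp add: compact_Int_closed)
    have oO: "open O'" unfolding O'_def
      by (intro open_Collect_conj open_Collect_less continuous_intros)
    have bdry: "u (\<zeta>, g \<zeta>) < ereal (q \<eta> \<zeta>)" if "\<zeta> \<in> A - O'" for \<zeta>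
    proof -
      consider "norm \<zeta> = s" | "norm (\<zeta> - e) = s" | "norm \<zeta> = R"
        using \<open>\<zeta> \<in> A - O'\<close> by (force simp: A_def O'_def)
      then show ?thesis
      proof cases
        case 1 then show ?thesis using s1(2)[of \<zeta>] s(2) nz[of \<zeta>] that by auto
      next
        case 2 then show ?thesis using s2(2)[of \<zeta>] s(3) nz[of \<zeta>] that by auto
      next
        case 3
        have "(\<zeta>, g \<zeta>) \<in> bidisk" using g1[of \<zeta>] 3 R(1) by (simp add: bidisk_def)
        then have "u (\<zeta>, g \<zeta>) \<le> 0" using u unfolding PSH_minus_def by blast
        moreover have "R * (R - norm e) \<le> norm \<zeta> * norm (\<zeta> - e)"
          using 3 R0 e(2) norm_triangle_ineq2[of \<zeta> e] by (intro mult_mono) auto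
        then have "L \<le> ln (norm \<zeta> * norm (\<zeta> - e))"
          unfolding L_def using R0 e(2) nz[of \<zeta>] that by (subst ln_le_cancel_iff) auto
        then have "L \<le> ln (norm \<zeta>) + ln (norm (\<zeta> - e))"
          using nz[of \<zeta>] that by (simp add: ln_mult)
        then have "0 \<le> (1 - \<eta>) * (ln (norm \<zeta>) + ln (norm (\<zeta> - e)) - L)"
          using \<eta> by simp
        moreover have "R\<^sup>2 < 1" using R0 R(1) by (simp add: power_less_one_iff)
        then have "0 < \<eta> * (1 - (norm \<zeta>)\<^sup>2)" using \<eta> 3 by simp
        ultimately show ?thesis unfolding q_def
          by (metis add_nonneg_pos ereal_less(2) order_le_less_trans)
      qed
    qed
    have mean: "\<forall>\<^sub>F r in at_right 0. ((\<lambda>t. q \<eta> (\<zeta> + of_real r * cis t)) has_integral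
        (2*pi * (q \<eta> \<zeta> - \<eta> * r\<^sup>2))) {0..2*pi}" if "\<zeta> \<in> O'" for \<zeta>
    proof -
      have "\<forall>\<^sub>F r in at_right 0. r \<in> {0<..<s}" by (rule eventually_at_right_real[OF s(1)])
      then show ?thesis
      proof eventually_elim
        case (elim r)
        have r: "0 \<le> r" "r < norm \<zeta>" "r < norm (\<zeta> - e)" using elim that by (auto simp: O'_def)
        have i1: "((\<lambda>t. ln (norm (\<zeta> + of_real r * cis t))) has_integral (2*pi * ln (norm \<zeta>))) {0..2*pi}"
          by (rule circle_mean_ln_norm[OF r(1,2)])
        have i2: "((\<lambda>t. ln (norm (\<zeta> + of_real r * cis t - e))) has_integral (2*pi * ln (norm (\<zeta> - e)))) {0..2*pi}"
          using circle_mean_ln_norm[OF r(1,3)] by (simp add: algebra_simps)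
        have i3: "((\<lambda>t. (norm (\<zeta> + of_real r * cis t))\<^sup>2) has_integral (2*pi * ((norm \<zeta>)\<^sup>2 + r\<^sup>2))) {0..2*pi}"
          using circle_mean_norm_sq[of 1 \<zeta> "of_real r"] by simp
        note const = has_integral_const_real[of _ 0 "2*pi"]
        from has_integral_add[OF
            has_integral_mult_right[OF has_integral_diff[OF has_integral_add[OF i1 i2] const[of L]], of "1 - \<eta>"]
            has_integral_mult_right[OF has_integral_diff[OF const[of 1] i3], of \<eta>]]
        show ?case unfolding q_def by (simp add: algebra_simps)
      qed
    qed
    have cq: "continuous_on A (q \<eta>)"
      unfolding q_def using nz by (intro continuous_intros) auto
    show ?thesis unfolding g_def
      by (rule psh_parabola_max_principle[OF u cA _ oO _ _ cq \<eta>(1) mean bdry[unfolded g_def]])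
         (use g1 R(1) s z in \<open>auto simp: A_def O'_def g_def\<close>)
  qed
  have "\<forall>\<^sub>F \<eta> in at_right 0. u (z, g z) \<le> ereal (q \<eta> z)"
    using eventually_at_right_real[OF zero_less_one] by eventually_elim (use key in auto)
  moreover have "((\<lambda>\<eta>. ereal (q \<eta> z)) \<longlongrightarrow> ereal (q 0 z)) (at_right 0)"
    unfolding q_def by (intro tendsto_intros)
  ultimately have "u (z, g z) \<le> ereal (q 0 z)"
    by (intro tendsto_lowerbound[of _ _ "at_right 0"]) auto
  then show ?thesis by (simp add: q_def g_def L_def)
qed

section \<open>Logarithms of moduli as negative plurisubharmonic functions\<close>

lemma tendsto_elog:
  assumes "(f \<longlongrightarrow> l) F" and "0 \<le> l" and "\<forall>\<^sub>F x in F. 0 \<le> f x"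
  shows "((\<lambda>x. elog (f x)) \<longlongrightarrow> elog l) F"
proof (cases "l = 0")
  case True
  have "\<forall>\<^sub>F x in F. elog (f x) < ereal c" for c
  proof -
    have "\<forall>\<^sub>F x in F. f x < exp c" using order_tendstoD(2)[OF assms(1), of "exp c"] True by simp
    with assms(3) show ?thesis
    proof eventually_elim
      case (elim x)
      have "ln (f x) < ln (exp c)" if "f x \<noteq> 0"
        using that elim by (subst ln_less_cancel_iff) auto
      then show ?case by (simp add: elog_def)
    qed
  qed
  then show ?thesis using True by (simp add: elog_def tendsto_MInfty)
next
  case False
  then have "((\<lambda>x. ereal (ln (f x))) \<longlongrightarrow> ereal (ln l)) F"
    by (intro tendsto_intros assms(1))
  moreover have "\<forall>\<^sub>F x in F. ereal (ln (f x)) = elog (f x)"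
    using tendsto_imp_eventually_ne[OF assms(1) False] by eventually_elim (simp add: elog_def)
  ultimately have "((\<lambda>x. elog (f x)) \<longlongrightarrow> ereal (ln l)) F" by (rule Lim_transform_eventually)
  then show ?thesis using False by (simp add: elog_def[of l])
qed

lemma usc_on_elog:
  assumes "continuous_on \<Omega> h" and "\<And>x. x \<in> \<Omega> \<Longrightarrow> 0 \<le> h x"
  shows "usc_on \<Omega> (\<lambda>x. elog (h x))"
  unfolding usc_on_iff_eventually
proof (intro ballI allI impI)
  fix x c assume x: "x \<in> \<Omega>" "elog (h x) < c"
  have "\<forall>\<^sub>F y in at x within \<Omega>. y \<in> \<Omega>" by (simp add: eventually_at_filter)
  then have "\<forall>\<^sub>F y in at x within \<Omega>. 0 \<le> h y" by eventually_elim (rule assms(2))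
  moreover have "(h \<longlongrightarrow> h x) (at x within \<Omega>)" using assms(1) x(1) by (simp add: continuous_on_def)
  ultimately have "((\<lambda>y. elog (h y)) \<longlongrightarrow> elog (h x)) (at x within \<Omega>)"
    using assms(2)[OF x(1)] by (intro tendsto_elog)
  from order_tendstoD(2)[OF this x(2)] show "\<forall>\<^sub>F y in at x within \<Omega>. elog (h y) < c" .
qed

text \<open>
  Roots on the circle are avoided by passing to slightly smaller radii; since the function is
  nonpositive, Fatou's lemma transfers Jensen's inequality to the limit radius.
\<close>
lemma elog_poly_le_circle_mean:
  fixes p :: "complex poly"
  assumes r: "0 < r" and \<alpha>: "0 < \<alpha>" and le1: "\<And>\<zeta>. \<zeta> \<in> cball c r \<Longrightarrow> norm (poly p \<zeta>) \<le> 1"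
  shows "elog (norm (poly p c) powr \<alpha>) \<le> circle_mean (\<lambda>\<zeta>. elog (norm (poly p \<zeta>) powr \<alpha>)) c r"
proof (cases "poly p c = 0")
  case True
  then show ?thesis by (simp add: elog_def)
next
  case False
  define v where "v = (\<lambda>\<zeta>. elog (norm (poly p \<zeta>) powr \<alpha>))"
  define K where "K = 2*pi * (- \<alpha> * ln (norm (poly p c)))"
  have v_neg: "v \<zeta> \<le> 0" if "\<zeta> \<in> cball c r" for \<zeta>
    using le1[OF that] \<alpha> elog_mono[of "norm (poly p \<zeta>) powr \<alpha>" 1]
    by (simp add: v_def elog_def[of 1] powr_le1 zero_ereal_def)
  have in_ball: "c + of_real \<rho> * cis t \<in> cball c r" if "0 < \<rho>" "\<rho> \<le> r" for \<rho> t
    using that by (simp add: dist_norm norm_mult)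
  have K0: "0 \<le> K" using le1[of c] r \<alpha> False by (simp add: K_def mult_nonneg_nonpos)
  have rootfree: "(\<integral>\<^sup>+t\<in>{0..2*pi}. e2ennreal (- v (c + of_real \<rho> * cis t)) \<partial>lborel) \<le> ennreal K"
    if \<rho>: "0 < \<rho>" "\<rho> \<le> r" "\<And>t. poly p (c + of_real \<rho> * cis t) \<noteq> 0" for \<rho>
  proof -
    let ?l = "\<lambda>t. ln (norm (poly p (c + of_real \<rho> * cis t)))"
    note J = ln_poly_circle_mean[OF \<rho>(1) False \<rho>(3)]
    have "e2ennreal (- v (c + of_real \<rho> * cis t)) = ennreal (- \<alpha> * ?l t)" for t
      using \<rho>(3)[of t] by (simp add: v_def elog_def ln_powr)
    moreover have "(\<integral>\<^sup>+t\<in>{0..2*pi}. ennreal (- \<alpha> * ?l t) \<partial>lborel) = ennreal (integral {0..2*pi} (\<lambda>t. - \<alpha> * ?l t))"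
    proof (rule nn_integral_eq_integral_Icc)
      show "continuous_on {0..2*pi} (\<lambda>t. - \<alpha> * ?l t)" using J by (intro continuous_on_mult continuous_on_const) simp
      show "0 \<le> - \<alpha> * ?l t" for t
        using le1[OF in_ball[OF \<rho>(1,2)]] \<rho>(3)[of t] \<alpha> by (simp add: mult_nonneg_nonpos)
    qed
    moreover have "integral {0..2*pi} (\<lambda>t. - \<alpha> * ?l t) = - \<alpha> * integral {0..2*pi} ?l" by simp
    moreover have "- \<alpha> * integral {0..2*pi} ?l \<le> K"
      using mult_left_mono[OF conjunct2[OF J], of \<alpha>] \<alpha> by (simp add: K_def mult_ac)
    ultimately show ?thesis by (simp add: ennreal_leI del: integral_mult_right)
  qed
  \<comment> \<open>Only finitely many radii meet a root, so \<open>X\<close> increases to \<open>r\<close> through root-free ones.\<close>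
  let ?F = "(\<lambda>\<zeta>. norm (\<zeta> - c)) ` {\<zeta>. poly p \<zeta> = 0} - {r}"
  have "p \<noteq> 0" using False by auto
  then have "open (- ?F)" by (intro open_Compl finite_imp_closed finite_Diff finite_imageI poly_roots_finite)
  then obtain d where d: "0 < d" "\<And>\<rho>. dist \<rho> r < d \<Longrightarrow> \<rho> \<notin> ?F"
    by (metis ComplD ComplI Diff_iff insertI1 open_dist)
  define s where "s = min d r"
  define X where "X = (\<lambda>n. r - s * inverse (real (Suc (Suc n))))"
  have s: "0 < s" using d(1) r by (simp add: s_def)
  have "s * inverse (real (Suc (Suc n))) < s * 1" for n
    using s by (intro mult_strict_left_mono) (auto simp: field_simps)
  then have X: "0 < X n" "X n < r" "dist (X n) r < d" for n
    using s by (auto simp: X_def s_def dist_real_def intro: less_le_trans)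
  have nz: "poly p (c + of_real (X n) * cis t) \<noteq> 0" for n t
  proof
    assume "poly p (c + of_real (X n) * cis t) = 0"
    then have "norm (c + of_real (X n) * cis t - c) \<in> (\<lambda>\<zeta>. norm (\<zeta> - c)) ` {\<zeta>. poly p \<zeta> = 0}" by blast
    then show False using d(2)[OF X(3)[of n]] X(1,2)[of n] by (simp add: norm_mult)
  qed
  have limX: "X \<longlonglongrightarrow> r"
  proof -
    have "X \<longlonglongrightarrow> r - s * 0" unfolding X_def
      by (intro tendsto_intros LIMSEQ_Suc[OF LIMSEQ_inverse_real_of_nat])
    then show ?thesis by simp
  qed
  let ?g = "\<lambda>\<rho> t. e2ennreal (- v (c + of_real \<rho> * cis t)) * indicator {0..2*pi} t"
  have meas: "?g \<rho> \<in> borel_measurable lborel" for \<rho>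
  proof -
    have "(\<lambda>t. norm (poly p (c + of_real \<rho> * cis t)) powr \<alpha>) \<in> borel_measurable borel"
      using \<alpha> by (intro borel_measurable_continuous_onI continuous_on_powr' continuous_intros) auto
    moreover have "elog \<in> borel_measurable borel"
      unfolding elog_def[abs_def] by measurable
    ultimately have [measurable]: "(\<lambda>t. v (c + of_real \<rho> * cis t)) \<in> borel_measurable borel"
      unfolding v_def by (rule measurable_compose)
    show ?thesis by measurable
  qed
  have "(\<lambda>n. ?g (X n) t) \<longlonglongrightarrow> ?g r t" for t
  proof -
    have "(\<lambda>n. norm (poly p (c + of_real (X n) * cis t)) powr \<alpha>) \<longlonglongrightarrow>
        norm (poly p (c + of_real r * cis t)) powr \<alpha>"
      using \<alpha> by (intro tendsto_powr' tendsto_intros limX) auto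
    then have "(\<lambda>n. v (c + of_real (X n) * cis t)) \<longlonglongrightarrow> v (c + of_real r * cis t)"
      unfolding v_def by (intro tendsto_elog) auto
    then have "(\<lambda>n. e2ennreal (- v (c + of_real (X n) * cis t))) \<longlonglongrightarrow> e2ennreal (- v (c + of_real r * cis t))"
      by (intro continuous_on_tendsto_compose[OF continuous_on_e2ennreal[of UNIV]] tendsto_uminus_ereal) auto
    then show ?thesis by (cases "t \<in> {0..2*pi}") simp_all
  qed
  then have "liminf (\<lambda>n. ?g (X n) t) = ?g r t" for t
    by (intro lim_imp_Liminf) auto
  then have "(\<integral>\<^sup>+t. ?g r t \<partial>lborel) = (\<integral>\<^sup>+t. liminf (\<lambda>n. ?g (X n) t) \<partial>lborel)" by simp
  also have "\<dots> \<le> liminf (\<lambda>n. \<integral>\<^sup>+t. ?g (X n) t \<partial>lborel)"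
    by (rule nn_integral_liminf) (rule meas)
  also have "\<dots> \<le> liminf (\<lambda>n. ennreal K)"
    by (intro Liminf_mono always_eventually allI rootfree X(1) less_imp_le[OF X(2)] nz)
  also have "\<dots> = ennreal K" by (simp add: Liminf_const)
  finally have N: "enn2ereal (\<integral>\<^sup>+t\<in>{0..2*pi}. e2ennreal (- v (c + of_real r * cis t)) \<partial>lborel) \<le> ereal K"
    using K0 by (simp add: less_eq_ennreal.rep_eq)
  have "e2ennreal (v (c + of_real r * cis t)) = 0" for t
    using v_neg[OF in_ball[OF r order_refl]] by (rule e2ennreal_neg)
  then have "circle_mean v c r
      = (0 - enn2ereal (\<integral>\<^sup>+t\<in>{0..2*pi}. e2ennreal (- v (c + of_real r * cis t)) \<partial>lborel)) / ereal (2*pi)"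
    unfolding circle_mean_def by (simp add: zero_ennreal.rep_eq)
  also have "\<dots> \<ge> (0 - ereal K) / ereal (2*pi)"
    by (intro ereal_divide_right_mono ereal_minus_mono N) auto
  also have "(0 - ereal K) / ereal (2*pi) = v c"
    using False by (simp add: K_def v_def elog_def ln_powr zero_ereal_def)
  finally show ?thesis by (simp add: v_def)
qed

lemma open_bidisk: "open bidisk"
  unfolding bidisk_def by (intro open_Times open_ball)

lemma elog_norm_powr_in_PSH_minus:
  fixes f :: "complex \<times> complex \<Rightarrow> complex"
  assumes cont: "continuous_on UNIV f"
    and lines: "\<And>a1 a2 b1 b2. \<exists>p. \<forall>\<zeta>. f (a1 + \<zeta> * b1, a2 + \<zeta> * b2) = poly p \<zeta>"
    and le1: "\<And>z. z \<in> bidisk \<Longrightarrow> norm (f z) \<le> 1" and \<alpha>: "0 < \<alpha>"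
  shows "(\<lambda>z. elog (norm (f z) powr \<alpha>)) \<in> PSH_minus"
proof -
  let ?h = "\<lambda>z. norm (f z) powr \<alpha>"
  have ch: "continuous_on UNIV ?h"
    using \<alpha> by (intro continuous_on_powr' continuous_intros cont) auto
  have fin: "elog x < \<infinity>" for x by (simp add: elog_def)
  have "subharmonic_on {\<zeta>. (a1 + \<zeta> * b1, a2 + \<zeta> * b2) \<in> bidisk} (\<lambda>\<zeta>. elog (?h (a1 + \<zeta> * b1, a2 + \<zeta> * b2)))"
    for a1 a2 b1 b2
  proof -
    obtain p where p: "\<And>\<zeta>. f (a1 + \<zeta> * b1, a2 + \<zeta> * b2) = poly p \<zeta>" using lines by metis
    let ?D = "{\<zeta>. (a1 + \<zeta> * b1, a2 + \<zeta> * b2) \<in> bidisk}"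
    have "open ((\<lambda>\<zeta>. (a1 + \<zeta> * b1, a2 + \<zeta> * b2)) -` bidisk)"
      by (intro open_vimage open_bidisk continuous_intros)
    then have "open ?D" by (simp add: vimage_def)
    moreover have "usc_on ?D (\<lambda>\<zeta>. elog (norm (poly p \<zeta>) powr \<alpha>))"
      using \<alpha> by (intro usc_on_elog continuous_on_powr' continuous_intros) auto
    moreover have "elog (norm (poly p c) powr \<alpha>) \<le> circle_mean (\<lambda>\<zeta>. elog (norm (poly p \<zeta>) powr \<alpha>)) c r"
      if "0 < r" "cball c r \<subseteq> ?D" for c r
    proof (rule elog_poly_le_circle_mean[OF that(1) \<alpha>])
      fix \<zeta> assume "\<zeta> \<in> cball c r"
      then have "(a1 + \<zeta> * b1, a2 + \<zeta> * b2) \<in> bidisk" using that(2) by blast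
      from le1[OF this] show "norm (poly p \<zeta>) \<le> 1" by (simp add: p)
    qed
    ultimately show ?thesis unfolding subharmonic_on_def p using fin by blast
  qed
  moreover have "usc_on bidisk (\<lambda>z. elog (?h z))"
    by (intro usc_on_elog continuous_on_subset[OF ch]) auto
  ultimately have "psh_on bidisk (\<lambda>z. elog (?h z))"
    unfolding psh_on_def using open_bidisk fin by blast
  moreover have "elog (?h z) \<le> 0" if "z \<in> bidisk" for z
    using elog_mono[of "?h z" 1] le1[OF that] \<alpha> by (simp add: powr_le1 elog_def[of 1] zero_ereal_def)
  ultimately show ?thesis unfolding PSH_minus_def by blast
qed

section \<open>Bounds for Green functions\<close>

lemma log_pole_at_elog:
  assumes "0 < K" and "\<forall>\<^sub>F w in at a. 0 \<le> h w \<and> h w \<le> K * norm (w - a)"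
  shows "log_pole_at (\<lambda>w. elog (h w)) a"
  unfolding log_pole_at_def
proof (intro exI)
  have "\<forall>\<^sub>F w in at a. w \<noteq> a" by (simp add: eventually_at_filter)
  with assms(2) show "\<forall>\<^sub>F w in at a. elog (h w) \<le> elog (norm (w - a)) + ereal (ln K)"
  proof eventually_elim
    case (elim w)
    then have "elog (h w) \<le> elog (K * norm (w - a))" by (intro elog_mono) auto
    also have "\<dots> = elog (norm (w - a)) + ereal (ln K)"
      using elim(2) assms(1) by (simp add: elog_def ln_mult)
    finally show ?case .
  qed
qed

lemma eventually_at_in_bidisk: "a \<in> bidisk \<Longrightarrow> \<forall>\<^sub>F w in at a. w \<in> bidisk"
  using open_bidisk by (simp add: eventually_at_in_open')

text \<open>
  A conic through \<open>S\<close> gives a competitor: the logarithm of the modulus of its equation, divided by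
  a bound for it on the bidisk.
\<close>
lemma green_ge_conic:
  fixes S :: "(complex \<times> complex) set" and e c :: complex
  assumes S: "S \<subseteq> bidisk" and zero: "\<And>a. a \<in> S \<Longrightarrow> fst a * (fst a - e) = c * snd a"
  shows "elog (norm (z1 * (z1 - e) - c * z2) / (1 + norm e + norm c)) \<le> green S (z1, z2)"
proof -
  define M where "M = 1 + norm e + norm c"
  define f where "f = (\<lambda>w::complex \<times> complex. (fst w * (fst w - e) - c * snd w) / of_real M)"
  have M: "0 < M" unfolding M_def by (smt (verit) norm_ge_zero)
  have nf: "norm (f w) = norm (fst w * (fst w - e) - c * snd w) / M" for w
    using M by (simp add: f_def norm_divide)
  have "(\<lambda>w. elog (norm (f w) powr 1)) \<in> PSH_minus"
  proof (rule elog_norm_powr_in_PSH_minus)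
    show "continuous_on UNIV f" unfolding f_def using M by (intro continuous_intros) auto
    fix a1 a2 b1 b2 :: complex
    let ?p = "smult (1 / of_real M) ([:a1, b1:] * [:a1 - e, b1:] - smult c [:a2, b2:])"
    have "f (a1 + \<zeta> * b1, a2 + \<zeta> * b2) = poly ?p \<zeta>" for \<zeta>
      by (simp add: f_def add_divide_distrib diff_divide_distrib algebra_simps)
    then show "\<exists>p. \<forall>\<zeta>. f (a1 + \<zeta> * b1, a2 + \<zeta> * b2) = poly p \<zeta>" by blast
  next
    fix w assume "w \<in> bidisk"
    then have w: "norm (fst w) \<le> 1" "norm (snd w) \<le> 1" by (auto simp: bidisk_def)
    have "norm (fst w * (fst w - e) - c * snd w) \<le> norm (fst w) * norm (fst w - e) + norm c * norm (snd w)"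
      by (metis norm_mult norm_triangle_ineq4)
    also have "\<dots> \<le> 1 * (1 + norm e) + norm c * 1"
      using w norm_triangle_ineq4[of "fst w" e] by (intro add_mono mult_mono) auto
    finally show "norm (f w) \<le> 1" using M by (simp add: nf M_def)
  qed simp
  then have psh: "(\<lambda>w. elog (norm (f w))) \<in> PSH_minus" by simp
  have "log_pole_at (\<lambda>w. elog (norm (f w))) a" if a: "a \<in> S" for a
  proof (rule log_pole_at_elog)
    show "0 < (2 + norm e + norm c) / M" using M by (smt (verit) divide_pos_pos norm_ge_zero)
    have a_in: "a \<in> bidisk" using a S by blast
    show "\<forall>\<^sub>F w in at a. 0 \<le> norm (f w) \<and> norm (f w) \<le> (2 + norm e + norm c) / M * norm (w - a)"
      using eventually_at_in_bidisk[OF a_in]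
    proof eventually_elim
      case (elim w)
      have "norm (fst w) \<le> 1" "norm (fst a) \<le> 1" using elim a_in by (auto simp: bidisk_def)
      then have b: "norm (fst w + fst a - e) \<le> 2 + norm e"
        using norm_triangle_ineq4[of "fst w + fst a" e] norm_triangle_ineq[of "fst w" "fst a"] by linarith
      have n1: "norm (fst w - fst a) \<le> norm (w - a)" and n2: "norm (snd w - snd a) \<le> norm (w - a)"
        by (metis fst_diff norm_fst_le prod.collapse, metis snd_diff norm_snd_le prod.collapse)
      have "fst w * (fst w - e) - c * snd w = (fst w - fst a) * (fst w + fst a - e) - c * (snd w - snd a)"
        using zero[OF a] by (simp add: algebra_simps)
      then have "norm (fst w * (fst w - e) - c * snd w)
          \<le> norm (fst w - fst a) * norm (fst w + fst a - e) + norm c * norm (snd w - snd a)"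
        by (metis norm_mult norm_triangle_ineq4)
      also have "\<dots> \<le> norm (w - a) * (2 + norm e) + norm c * norm (w - a)"
        by (intro add_mono mult_mono b n1 n2) auto
      finally show ?case using M by (simp add: nf divide_right_mono algebra_simps)
    qed
  qed
  then have "elog (norm (f (z1, z2))) \<le> green S (z1, z2)"
    unfolding green_def using psh by (intro SUP_upper) auto
  then show ?thesis by (simp add: nf M_def)
qed

text \<open>
  The denominator makes the form bounded by \<open>1\<close> on the bidisk and \<open>1\<close>-Lipschitz, so that products of
  such forms need no further constants.
\<close>
definition affine_form :: "complex \<Rightarrow> complex \<Rightarrow> complex \<Rightarrow> complex \<times> complex \<Rightarrow> complex" where
  "affine_form p q r w = (p * fst w + q * snd w + r) / of_real (norm p + norm q + norm r)"

lemma norm_affine_form_le_1: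
  assumes "w \<in> bidisk"
  shows "norm (affine_form p q r w) \<le> 1"
proof -
  have w: "norm (fst w) \<le> 1" "norm (snd w) \<le> 1" using assms by (auto simp: bidisk_def)
  have "norm (p * fst w + q * snd w + r) \<le> norm p * norm (fst w) + norm q * norm (snd w) + norm r"
    by (metis norm_mult norm_triangle_mono norm_triangle_ineq order_refl)
  also have "\<dots> \<le> norm p * 1 + norm q * 1 + norm r"
    using w by (intro add_mono mult_left_mono) auto
  finally have le: "norm (p * fst w + q * snd w + r) \<le> norm p + norm q + norm r" by simp
  have "0 \<le> norm p + norm q + norm r" by simp
  then have "norm (affine_form p q r w) = norm (p * fst w + q * snd w + r) / (norm p + norm q + norm r)"
    unfolding affine_form_def norm_divide norm_of_real by (simp only: abs_of_nonneg)
  also have "\<dots> \<le> 1" using le \<open>0 \<le> norm p + norm q + norm r\<close> unfolding divide_le_eq_1 by argo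
  finally show ?thesis .
qed

lemma norm_affine_form_le_dist:
  assumes "affine_form p q r a = 0"
  shows "norm (affine_form p q r w) \<le> norm (w - a)"
proof (cases "norm p + norm q + norm r = 0")
  case True
  then show ?thesis by (simp only: affine_form_def of_real_0 div_by_0) simp
next
  case False
  have N: "0 < norm p + norm q + norm r" using False by (smt (verit) norm_ge_zero)
  have n1: "norm (fst w - fst a) \<le> norm (w - a)" and n2: "norm (snd w - snd a) \<le> norm (w - a)"
    by (metis fst_diff norm_fst_le prod.collapse, metis snd_diff norm_snd_le prod.collapse)
  have "of_real (norm p + norm q + norm r) \<noteq> (0::complex)" using False of_real_eq_0_iff by blast
  then have "p * fst a + q * snd a + r = 0" using assms unfolding affine_form_def by (simp only: divide_eq_0_iff) simp
  then have "p * fst w + q * snd w + r = p * (fst w - fst a) + q * (snd w - snd a)"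
    by (simp add: algebra_simps add_eq_0_iff)
  then have "norm (p * fst w + q * snd w + r) \<le> norm p * norm (fst w - fst a) + norm q * norm (snd w - snd a)"
    by (metis norm_mult norm_triangle_ineq)
  also have "\<dots> \<le> norm p * norm (w - a) + norm q * norm (w - a)"
    by (intro add_mono mult_left_mono n1 n2) auto
  also have "\<dots> \<le> norm (w - a) * (norm p + norm q + norm r)" by (simp add: algebra_simps)
  finally show ?thesis using N unfolding affine_form_def norm_divide norm_of_real
    by (simp add: divide_le_eq)
qed

text \<open>
  If each pole lies on two of the three lines, the product of their equations vanishes there to second
  order, and half of its logarithm has a logarithmic pole of weight one.
\<close>
lemma green_ge_three_lines:
  assumes S: "S \<subseteq> bidisk"
    and zero: "\<And>a. a \<in> S \<Longrightarrow> (affine_form p1 q1 r1 a = 0 \<and> affine_form p2 q2 r2 a = 0)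
      \<or> (affine_form p1 q1 r1 a = 0 \<and> affine_form p3 q3 r3 a = 0)
      \<or> (affine_form p2 q2 r2 a = 0 \<and> affine_form p3 q3 r3 a = 0)"
  shows "elog (norm (affine_form p1 q1 r1 z * affine_form p2 q2 r2 z * affine_form p3 q3 r3 z) powr (1/2)) \<le> green S z"
proof -
  let ?l1 = "affine_form p1 q1 r1" let ?l2 = "affine_form p2 q2 r2" let ?l3 = "affine_form p3 q3 r3"
  define f where "f = (\<lambda>w. ?l1 w * ?l2 w * ?l3 w)"
  have cont: "continuous_on UNIV (affine_form p q r)" for p q r
    unfolding affine_form_def[abs_def] divide_inverse by (intro continuous_intros)
  have lin: "\<exists>P. \<forall>\<zeta>. affine_form p q r (a1 + \<zeta> * b1, a2 + \<zeta> * b2) = poly P \<zeta>" for p q r a1 a2 b1 b2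
  proof (intro exI allI)
    fix \<zeta>
    show "affine_form p q r (a1 + \<zeta> * b1, a2 + \<zeta> * b2)
      = poly (smult (1 / of_real (norm p + norm q + norm r)) [:p * a1 + q * a2 + r, p * b1 + q * b2:]) \<zeta>"
      unfolding affine_form_def by (simp add: add_divide_distrib algebra_simps)
  qed
  have psh: "(\<lambda>w. elog (norm (f w) powr (1/2))) \<in> PSH_minus"
  proof (rule elog_norm_powr_in_PSH_minus)
    show "continuous_on UNIV f" unfolding f_def by (intro continuous_intros cont)
    fix a1 a2 b1 b2 :: complex
    obtain P1 P2 P3 where "\<And>\<zeta>. ?l1 (a1 + \<zeta> * b1, a2 + \<zeta> * b2) = poly P1 \<zeta>"
      "\<And>\<zeta>. ?l2 (a1 + \<zeta> * b1, a2 + \<zeta> * b2) = poly P2 \<zeta>" "\<And>\<zeta>. ?l3 (a1 + \<zeta> * b1, a2 + \<zeta> * b2) = poly P3 \<zeta>"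
      using lin by metis
    then have "f (a1 + \<zeta> * b1, a2 + \<zeta> * b2) = poly (P1 * P2 * P3) \<zeta>" for \<zeta> by (simp add: f_def)
    then show "\<exists>p. \<forall>\<zeta>. f (a1 + \<zeta> * b1, a2 + \<zeta> * b2) = poly p \<zeta>" by blast
  next
    fix w assume "w \<in> bidisk"
    then show "norm (f w) \<le> 1"
      unfolding f_def norm_mult by (intro mult_le_one norm_affine_form_le_1 mult_nonneg_nonneg norm_ge_zero)
  qed simp
  have "log_pole_at (\<lambda>w. elog (norm (f w) powr (1/2))) a" if a: "a \<in> S" for a
  proof (rule log_pole_at_elog[of 1])
    have a_in: "a \<in> bidisk" using a S by blast
    show "\<forall>\<^sub>F w in at a. 0 \<le> norm (f w) powr (1/2) \<and> norm (f w) powr (1/2) \<le> 1 * norm (w - a)"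
      using eventually_at_in_bidisk[OF a_in]
    proof eventually_elim
      case (elim w)
      have two: "norm (x * y * t) \<le> (norm (w - a))\<^sup>2"
        if "norm x \<le> norm (w - a)" "norm y \<le> norm (w - a)" "norm t \<le> 1" for x y t :: complex
      proof -
        have "norm x * norm y * norm t \<le> norm (w - a) * norm (w - a) * 1"
          using that by (intro mult_mono) auto
        then show ?thesis by (simp add: norm_mult power2_eq_square)
      qed
      have "f w = ?l1 w * ?l2 w * ?l3 w" "f w = ?l1 w * ?l3 w * ?l2 w" "f w = ?l2 w * ?l3 w * ?l1 w"
        by (simp_all add: f_def)
      then have "norm (f w) \<le> (norm (w - a))\<^sup>2"
        using zero[OF a] two norm_affine_form_le_dist norm_affine_form_le_1[OF elim] by metis
      then have "norm (f w) powr (1/2) \<le> ((norm (w - a))\<^sup>2) powr (1/2)"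
        by (intro powr_mono2) auto
      then show ?case by (simp add: powr_half_sqrt)
    qed
  qed simp
  then have "elog (norm (f z) powr (1/2)) \<le> green S z"
    unfolding green_def using psh by (intro SUP_upper) auto
  then show ?thesis by (simp add: f_def)
qed

text \<open>
  The parabola \<open>w = \<kappa> \<zeta> (\<zeta> - e)\<close> through both poles is made to pass through \<open>(z1, z2)\<close>
  by the choice \<open>\<kappa> = z2 / (z1 (z1 - e))\<close>.
\<close>
lemma green_le_two_poles:
  fixes e z1 z2 :: complex
  assumes "(0, 0) \<in> S" "(e, 0) \<in> S" and "e \<noteq> 0" "norm e < R" "R < 1"
    and "norm (z2 / (z1 * (z1 - e))) * (R * (R + norm e)) < 1"
    and "z1 \<noteq> 0" "z1 \<noteq> e" "norm z1 < R"
  shows "green S (z1, z2) \<le> ereal (ln (norm z1) + ln (norm (z1 - e)) - ln (R * (R - norm e)))"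
  unfolding green_def
proof (rule SUP_least)
  fix u assume "u \<in> {u \<in> PSH_minus. \<forall>a\<in>S. log_pole_at u a}"
  then have "u \<in> PSH_minus" "log_pole_at u (0, 0)" "log_pole_at u (e, 0)" using assms by auto
  from psh_parabola_two_poles[OF this assms(3-9)]
  show "u (z1, z2) \<le> ereal (ln (norm z1) + ln (norm (z1 - e)) - ln (R * (R - norm e)))"
    using assms(7,8) by simp
qed

section \<open>Three poles tending to the origin along almost one line\<close>

theorem proposition1p6:
  fixes E :: "complex set"
    and \<rho> \<delta> :: "complex \<Rightarrow> complex"
    and a1 a2 a3 :: "complex \<Rightarrow> complex \<times> complex"
    and S :: "complex \<Rightarrow> (complex \<times> complex) set"
    and G :: "complex \<Rightarrow> complex \<times> complex \<Rightarrow> ereal"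
  assumes "E \<subseteq> - {0}" and "0 \<in> closure E"
    and "\<And>\<epsilon>. \<epsilon> \<in> E \<Longrightarrow> a1 \<epsilon> = (0, 0)"
    and "\<And>\<epsilon>. \<epsilon> \<in> E \<Longrightarrow> a2 \<epsilon> = (\<epsilon>, 0)"
    and "\<And>\<epsilon>. \<epsilon> \<in> E \<Longrightarrow> a3 \<epsilon> = (\<rho> \<epsilon>, \<delta> \<epsilon> * \<rho> \<epsilon>)"
    and "\<And>\<epsilon>. \<epsilon> \<in> E \<Longrightarrow> \<rho> \<epsilon> \<noteq> 0"
    and "\<And>\<epsilon>. \<epsilon> \<in> E \<Longrightarrow> distinct [a1 \<epsilon>, a2 \<epsilon>, a3 \<epsilon>]"
    and "\<And>\<epsilon>. \<epsilon> \<in> E \<Longrightarrow> S \<epsilon> = {a1 \<epsilon>, a2 \<epsilon>, a3 \<epsilon>}"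
    and "\<And>\<epsilon>. \<epsilon> \<in> E \<Longrightarrow> S \<epsilon> \<subseteq> bidisk"
    and "\<And>\<epsilon>. \<epsilon> \<in> E \<Longrightarrow> norm (a3 \<epsilon>) \<le> norm (a3 \<epsilon> - a2 \<epsilon>)"
    and "\<And>\<epsilon>. \<epsilon> \<in> E \<Longrightarrow> norm (a3 \<epsilon> - a2 \<epsilon>) \<le> norm \<epsilon>"
    and "(\<delta> \<longlongrightarrow> 0) (at 0 within E)"
    and "filterlim (\<lambda>\<epsilon>. norm (\<delta> \<epsilon> / \<epsilon>)) at_top (at 0 within E)"
    and "\<And>\<epsilon>. \<epsilon> \<in> E \<Longrightarrow> G \<epsilon> = green (S \<epsilon>)"
  shows "(\<forall>z1 z2. (z1, z2) \<in> bidisk - {(0, 0)} \<longrightarrow>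
            Liminf (at 0 within E) (\<lambda>\<epsilon>. G \<epsilon> (z1, z2))
              \<ge> max (2 * elog (norm z1)) (ereal (3/2) * elog (norm z2))) \<and>
         (\<forall>z1 z2. (z1, z2) \<in> bidisk - {(0, 0)} \<longrightarrow> norm z2 \<le> (norm z1)^2 \<longrightarrow>
            ((\<lambda>\<epsilon>. G \<epsilon> (z1, z2)) \<longlongrightarrow> 2 * elog (norm z1)) (at 0 within E))"
proof -
  let ?F = "at 0 within E"
  have "0 islimpt E" using assms(1,2) by (auto simp: closure_def)
  then have F: "\<not> trivial_limit ?F" by (simp add: trivial_limit_within)
  have evE: "\<forall>\<^sub>F \<epsilon> in ?F. \<epsilon> \<in> E" by (simp add: eventually_at_filter)
  have e0: "\<epsilon> \<noteq> 0" if "\<epsilon> \<in> E" for \<epsilon> using that assms(1) by auto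
  have S: "S \<epsilon> = {(0, 0), (\<epsilon>, 0), (\<rho> \<epsilon>, \<delta> \<epsilon> * \<rho> \<epsilon>)}" if "\<epsilon> \<in> E" for \<epsilon>
    using assms(3,4,5,8) that by simp
  have \<rho>_le: "norm (\<rho> \<epsilon>) \<le> norm (\<rho> \<epsilon> - \<epsilon>)" if "\<epsilon> \<in> E" for \<epsilon>
    using assms(10)[OF that] assms(4,5)[OF that] by (simp add: norm_Pair real_sqrt_le_iff power2_le_iff_abs_le)
  have \<rho>\<epsilon>_le: "norm (\<rho> \<epsilon> - \<epsilon>) \<le> norm \<epsilon>" if "\<epsilon> \<in> E" for \<epsilon>
    using assms(11)[OF that] assms(4,5)[OF that] norm_fst_le[of "\<rho> \<epsilon> - \<epsilon>" "\<delta> \<epsilon> * \<rho> \<epsilon>"] by simp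
  have \<rho>\<epsilon>: "\<rho> \<epsilon> - \<epsilon> \<noteq> 0" if "\<epsilon> \<in> E" for \<epsilon>
    using \<rho>_le[OF that] assms(6)[OF that] by auto
  have \<epsilon>_lim: "((\<lambda>\<epsilon>. \<epsilon>) \<longlongrightarrow> 0) ?F" by (rule tendsto_ident_at)
  \<comment> \<open>\<open>z1 (z1 - \<epsilon>) = c \<epsilon> * z2\<close> is the parabola through all three poles, and \<open>s \<epsilon>\<close> is the slope of
    the line through the second and the third one.\<close>
  define c where "c = (\<lambda>\<epsilon>. (\<rho> \<epsilon> - \<epsilon>) / \<delta> \<epsilon>)"
  define s where "s = (\<lambda>\<epsilon>. \<delta> \<epsilon> * \<rho> \<epsilon> / (\<rho> \<epsilon> - \<epsilon>))"
  have \<delta>0: "\<forall>\<^sub>F \<epsilon> in ?F. \<delta> \<epsilon> \<noteq> 0"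
    using assms(13)[unfolded filterlim_at_top_dense, rule_format, of 0] by eventually_elim auto
  have c_lim: "(c \<longlongrightarrow> 0) ?F"
  proof (rule Lim_null_comparison)
    show "((\<lambda>\<epsilon>. inverse (norm (\<delta> \<epsilon> / \<epsilon>))) \<longlongrightarrow> 0) ?F"
      by (rule tendsto_inverse_0_at_top[OF assms(13)])
    show "\<forall>\<^sub>F \<epsilon> in ?F. norm (c \<epsilon>) \<le> inverse (norm (\<delta> \<epsilon> / \<epsilon>))"
      using evE by eventually_elim (use \<rho>\<epsilon>_le in \<open>auto simp: c_def norm_divide divide_right_mono\<close>)
  qed
  have s_lim: "(s \<longlongrightarrow> 0) ?F"
  proof (rule Lim_null_comparison)
    show "((\<lambda>\<epsilon>. norm (\<delta> \<epsilon>)) \<longlongrightarrow> 0) ?F" by (rule tendsto_norm_zero[OF assms(12)])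
    show "\<forall>\<^sub>F \<epsilon> in ?F. norm (s \<epsilon>) \<le> norm (\<delta> \<epsilon>)"
      using evE
    proof eventually_elim
      case (elim \<epsilon>)
      have "norm (\<delta> \<epsilon>) * norm (\<rho> \<epsilon>) \<le> norm (\<delta> \<epsilon>) * norm (\<rho> \<epsilon> - \<epsilon>)"
        using \<rho>_le[OF elim] by (rule mult_left_mono) simp
      then show ?case using \<rho>\<epsilon>[OF elim] by (simp add: s_def norm_divide norm_mult divide_le_eq)
    qed
  qed
  have lower: "Liminf ?F (\<lambda>\<epsilon>. G \<epsilon> z) \<ge> L" if "\<forall>\<^sub>F \<epsilon> in ?F. A \<epsilon> \<le> G \<epsilon> z" "(A \<longlongrightarrow> L) ?F" for A L z
    using Liminf_mono[OF that(1)] lim_imp_Liminf[OF F that(2)] by simp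
  have lower1: "Liminf ?F (\<lambda>\<epsilon>. G \<epsilon> (z1, z2)) \<ge> 2 * elog (norm z1)" for z1 z2
  proof (rule lower)
    show "\<forall>\<^sub>F \<epsilon> in ?F. elog (norm (z1 * (z1 - \<epsilon>) - c \<epsilon> * z2) / (1 + norm \<epsilon> + norm (c \<epsilon>))) \<le> G \<epsilon> (z1, z2)"
      using evE \<delta>0
    proof eventually_elim
      case (elim \<epsilon>)
      show ?case unfolding assms(14)[OF elim(1)]
        by (rule green_ge_conic[OF assms(9)[OF elim(1)]]) (use S[OF elim(1)] elim(2) in \<open>auto simp: c_def\<close>)
    qed
    have "((\<lambda>\<epsilon>. norm (z1 * (z1 - \<epsilon>) - c \<epsilon> * z2) / (1 + norm \<epsilon> + norm (c \<epsilon>)))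
        \<longlongrightarrow> norm (z1 * (z1 - 0) - 0 * z2) / (1 + norm (0::complex) + norm (0::complex))) ?F"
      by (intro tendsto_intros \<epsilon>_lim c_lim) auto
    then have "((\<lambda>\<epsilon>. elog (norm (z1 * (z1 - \<epsilon>) - c \<epsilon> * z2) / (1 + norm \<epsilon> + norm (c \<epsilon>))))
        \<longlongrightarrow> elog (norm z1 * norm z1)) ?F"
      by (intro tendsto_elog) (auto simp: norm_mult)
    also have "elog (norm z1 * norm z1) = 2 * elog (norm z1)"
      by (simp add: elog_def ln_mult)
    finally show "((\<lambda>\<epsilon>. elog (norm (z1 * (z1 - \<epsilon>) - c \<epsilon> * z2) / (1 + norm \<epsilon> + norm (c \<epsilon>))))
        \<longlongrightarrow> 2 * elog (norm z1)) ?F" .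
  qed
  have lower2: "Liminf ?F (\<lambda>\<epsilon>. G \<epsilon> (z1, z2)) \<ge> ereal (3/2) * elog (norm z2)" for z1 z2
  proof (rule lower)
    let ?A = "\<lambda>\<epsilon>. norm (affine_form 0 1 0 (z1, z2) * affine_form (- \<delta> \<epsilon>) 1 0 (z1, z2)
        * affine_form (- s \<epsilon>) 1 (s \<epsilon> * \<epsilon>) (z1, z2))"
    show "\<forall>\<^sub>F \<epsilon> in ?F. elog (?A \<epsilon> powr (1/2)) \<le> G \<epsilon> (z1, z2)"
      using evE
    proof eventually_elim
      case (elim \<epsilon>)
      have "s \<epsilon> * (\<rho> \<epsilon> - \<epsilon>) = \<delta> \<epsilon> * \<rho> \<epsilon>" using \<rho>\<epsilon>[OF elim] by (simp add: s_def)
      then have "affine_form (- s \<epsilon>) 1 (s \<epsilon> * \<epsilon>) (\<rho> \<epsilon>, \<delta> \<epsilon> * \<rho> \<epsilon>) = 0"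
        by (simp add: affine_form_def algebra_simps)
      then show ?case unfolding assms(14)[OF elim]
        by (intro green_ge_three_lines assms(9)[OF elim]) (use S[OF elim] in \<open>auto simp: affine_form_def\<close>)
    qed
    have "(?A \<longlongrightarrow> norm (affine_form 0 1 0 (z1, z2) * affine_form (- 0) 1 0 (z1, z2)
        * affine_form (- 0) 1 (0 * 0) (z1, z2))) ?F"
      unfolding affine_form_def by (intro tendsto_intros \<epsilon>_lim s_lim assms(12)) auto
    then have "(?A \<longlongrightarrow> norm z2 ^ 3) ?F"
      by (simp add: affine_form_def norm_mult power3_eq_cube)
    then have "((\<lambda>\<epsilon>. elog (?A \<epsilon> powr (1/2))) \<longlongrightarrow> elog ((norm z2 ^ 3) powr (1/2))) ?F"
      by (intro tendsto_elog tendsto_powr' tendsto_const) auto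
    also have "elog ((norm z2 ^ 3) powr (1/2)) = ereal (3/2) * elog (norm z2)"
      by (simp add: elog_def ln_powr ln_realpow)
    finally show "((\<lambda>\<epsilon>. elog (?A \<epsilon> powr (1/2))) \<longlongrightarrow> ereal (3/2) * elog (norm z2)) ?F" .
  qed
  have upper: "Limsup ?F (\<lambda>\<epsilon>. G \<epsilon> (z1, z2)) \<le> 2 * elog (norm z1)"
    if z: "(z1, z2) \<in> bidisk - {(0, 0)}" "norm z2 \<le> (norm z1)\<^sup>2" for z1 z2
  proof -
    have z0: "z1 \<noteq> 0" using z by auto
    have z1: "norm z1 < 1" using z by (simp add: bidisk_def)
    \<comment> \<open>For \<open>\<bar>z2\<bar> = \<bar>z1\<bar>\<^sup>2\<close> the parabola may leave the bidisk over the unit disk, but over the disk of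
      radius \<open>R < 1\<close> it stays inside for small \<open>\<epsilon>\<close>.\<close>
    have *: "Limsup ?F (\<lambda>\<epsilon>. G \<epsilon> (z1, z2)) \<le> ereal (ln (norm z1) + ln (norm z1) - ln (R * R))"
      if R: "norm z1 < R" "R < 1" for R
    proof -
      have R0: "0 < R" using R(1) norm_ge_zero[of z1] by linarith
      have "((\<lambda>\<epsilon>. norm (z2 / (z1 * (z1 - \<epsilon>))) * (R * (R + norm \<epsilon>)))
          \<longlongrightarrow> norm (z2 / (z1 * (z1 - 0))) * (R * (R + norm (0::complex)))) ?F"
        by (intro tendsto_intros \<epsilon>_lim) (use z0 in auto)
      moreover have "norm (z2 / (z1 * (z1 - 0))) * (R * (R + norm (0::complex))) < 1"
      proof -
        have "norm (z2 / (z1 * (z1 - 0))) \<le> 1"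
          using z(2) z0 by (simp add: norm_divide norm_mult power2_eq_square)
        then have "norm (z2 / (z1 * (z1 - 0))) * (R * R) \<le> 1 * (R * R)" by (intro mult_right_mono) auto
        also have "\<dots> < 1" using R(2) R0 mult_strict_mono[of R 1 R 1] by simp
        finally show ?thesis by simp
      qed
      ultimately have ev1: "\<forall>\<^sub>F \<epsilon> in ?F. norm (z2 / (z1 * (z1 - \<epsilon>))) * (R * (R + norm \<epsilon>)) < 1"
        by (rule order_tendstoD(2))
      have ev2: "\<forall>\<^sub>F \<epsilon> in ?F. norm \<epsilon> < R"
        using order_tendstoD(2)[OF tendsto_norm_zero[OF \<epsilon>_lim] R0] .
      have ev3: "\<forall>\<^sub>F \<epsilon> in ?F. \<epsilon> \<noteq> z1"
        using tendsto_imp_eventually_ne[OF \<epsilon>_lim, of z1] z0 by simp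
      let ?B = "\<lambda>\<epsilon>. ereal (ln (norm z1) + ln (norm (z1 - \<epsilon>)) - ln (R * (R - norm \<epsilon>)))"
      have "\<forall>\<^sub>F \<epsilon> in ?F. G \<epsilon> (z1, z2) \<le> ?B \<epsilon>"
        using evE ev1 ev2 ev3
      proof eventually_elim
        case (elim \<epsilon>)
        show ?case unfolding assms(14)[OF elim(1)]
          by (rule green_le_two_poles) (use S[OF elim(1)] e0[OF elim(1)] elim R z0 in auto)
      qed
      then have "Limsup ?F (\<lambda>\<epsilon>. G \<epsilon> (z1, z2)) \<le> Limsup ?F ?B" by (rule Limsup_mono)
      also have "(?B \<longlongrightarrow> ereal (ln (norm z1) + ln (norm (z1 - 0)) - ln (R * (R - norm (0::complex))))) ?F"
        by (intro tendsto_intros \<epsilon>_lim) (use z0 R0 in auto)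
      then have "Limsup ?F ?B = ereal (ln (norm z1) + ln (norm z1) - ln (R * R))"
        by (subst lim_imp_Limsup[OF F]) auto
      finally show ?thesis .
    qed
    have "\<forall>\<^sub>F R in at_left 1. Limsup ?F (\<lambda>\<epsilon>. G \<epsilon> (z1, z2)) \<le> ereal (ln (norm z1) + ln (norm z1) - ln (R * R))"
      using eventually_at_left_real[OF z1] by eventually_elim (rule *, auto)
    moreover have "((\<lambda>R. ereal (ln (norm z1) + ln (norm z1) - ln (R * R)))
        \<longlongrightarrow> ereal (ln (norm z1) + ln (norm z1) - ln (1 * 1))) (at_left 1)"
      by (intro tendsto_intros) auto
    ultimately have "Limsup ?F (\<lambda>\<epsilon>. G \<epsilon> (z1, z2)) \<le> ereal (ln (norm z1) + ln (norm z1) - ln (1 * 1))"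
      by (intro tendsto_lowerbound[of _ _ "at_left 1"]) auto
    then show ?thesis using z0 by (simp add: elog_def)
  qed
  show ?thesis
  proof (intro conjI allI impI)
    fix z1 z2
    show "Liminf ?F (\<lambda>\<epsilon>. G \<epsilon> (z1, z2)) \<ge> max (2 * elog (norm z1)) (ereal (3/2) * elog (norm z2))"
      using lower1 lower2 by simp
  next
    fix z1 z2 assume z: "(z1, z2) \<in> bidisk - {(0, 0)}" "norm z2 \<le> (norm z1)\<^sup>2"
    note up = upper[OF z] and lo = lower1[of z1 z2]
    have "Liminf ?F (\<lambda>\<epsilon>. G \<epsilon> (z1, z2)) = 2 * elog (norm z1)"
      using Liminf_le_Limsup[OF F, of "\<lambda>\<epsilon>. G \<epsilon> (z1, z2)"] up lo by order
    moreover have "Limsup ?F (\<lambda>\<epsilon>. G \<epsilon> (z1, z2)) = 2 * elog (norm z1)"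
      using Liminf_le_Limsup[OF F, of "\<lambda>\<epsilon>. G \<epsilon> (z1, z2)"] up lo by order
    ultimately show "((\<lambda>\<epsilon>. G \<epsilon> (z1, z2)) \<longlongrightarrow> 2 * elog (norm z1)) ?F"
      by (rule Liminf_eq_Limsup[OF F])
  qed
qed

end
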